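(* Let $H$ be a finite dimensional weak Hopf algebra over a field $k$. Then the quotient group $\widetilde G(H)=G(H)/G_0(H)$ of the group of group-like elements of $H$ by its normal subgroup of trivial group-like elements is finite.
   Context: A weak Hopf algebra over a field $k$ is a $k$-vector space $H$ with an associative unital algebra structure $(m,1)$, a coassociative counital coalgebra structure $(\Delta,\epsilon)$ (Sweedler notation $\Delta(h)=h_{(1)}\otimes h_{(2)}$) and a linear map $S:H\to H$ (antipode) such that for all $f,g,h\in H$: $\Delta(hg)=\Delta(h)\Delta(g)$; $(\Delta\otimes\mathrm{id})\Delta(1)=(\Delta(1)\otimes1)(1\otimes\Delta(1))=(1\otimes\Delta(1))(\Delta(1)\otimes1)$; $\epsilon(fgh)=\epsilon(fg_{(1)})\epsilon(g_{(2)}h)=\epsilon(fg_{(2)})\epsilon(g_{(1)}h)$; $m(\mathrm{id}\otimes S)\Delta(h)=(\epsilon\otimes\mathrm{id})(\Delta(1)(h\otimes1))$; $m(S\otimes\mathrm{id})\Delta(h)=(\mathrm{id}\otimes\epsilon)((1\otimes h)\Delta(1))$; $S(h)=S(h_{(1)})h_{(2)}S(h_{(3)})$. ($\Delta(1)\neq1\otimes1$ in general.) The source base of $H$ is $H_s=\varepsilon_s(H)$ with $\varepsilon_s(h)=1_{(1)}\epsilon(h1_{(2)})$; it is a subalgebra. An element $g\in H$ is group-like if it is invertible and $\Delta(g)=(g\otimes g)\Delta(1)=\Delta(1)(g\otimes g)$. Group-like elements form a group $G(H)$ under multiplication. A group-like element is trivial if it has the form $S(y)y^{-1}$ with $y\in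 H_s$ invertible; trivial group-like elements form a normal subgroup $G_0(H)$ of $G(H)$. *)

theory Defs
  imports Complex_Main "HOL-Library.Poly_Mapping" "HOL-Algebra.Coset"
begin

section \<open>Tensor powers of a vector space\<close>

text \<open>
  The free vector space on a type \<open>'x\<close> over the field \<open>'k\<close> is \<open>'x \<Rightarrow>\<^sub>0 'k\<close>.  The tensor powers
  \<open>H \<otimes> H\<close> and \<open>H \<otimes> H \<otimes> H\<close> are its quotients, for \<open>'x = 'h \<times> 'h\<close> and \<open>'x = 'h \<times> 'h \<times> 'h\<close>, by the
  relations expressing linearity in each slot; a tensor is an equivalence class of formal sums.
\<close>

definition free_scale :: "'k::field \<Rightarrow> ('x \<Rightarrow>\<^sub>0 'k) \<Rightarrow> ('x \<Rightarrow>\<^sub>0 'k)" where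
  "free_scale c = Poly_Mapping.map ((*) c)"

definition linear_extension ::
    "('k::field \<Rightarrow> 'w::comm_monoid_add \<Rightarrow> 'w) \<Rightarrow> ('x \<Rightarrow> 'w) \<Rightarrow> ('x \<Rightarrow>\<^sub>0 'k) \<Rightarrow> 'w" where
  "linear_extension sc f x = (\<Sum>p\<in>Poly_Mapping.keys x. sc (Poly_Mapping.lookup x p) (f p))"

text \<open>
  A slot is an insertion \<open>\<iota> :: 'h \<Rightarrow> 'x\<close> that varies one component of a tuple and keeps the
  others fixed.
\<close>

definition slots2 :: "('h \<Rightarrow> 'h \<times> 'h) set" where
  "slots2 = {(\<lambda>a. (a, b)) | b. True} \<union> {(\<lambda>b. (a, b)) | a. True}"

definition slots3 :: "('h \<Rightarrow> 'h \<times> 'h \<times> 'h) set" where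
  "slots3 = {(\<lambda>a. (a, b, c)) | b c. True} \<union> {(\<lambda>b. (a, b, c)) | a c. True}
    \<union> {(\<lambda>c. (a, b, c)) | a b. True}"

definition multilinear_relations ::
    "('k::field \<Rightarrow> 'h::ab_group_add \<Rightarrow> 'h) \<Rightarrow> ('h \<Rightarrow> 'x) set \<Rightarrow> ('x \<Rightarrow>\<^sub>0 'k) set" where
  "multilinear_relations s K = module.span free_scale
    ({Poly_Mapping.single (\<iota> (a + b)) 1 - Poly_Mapping.single (\<iota> a) 1 - Poly_Mapping.single (\<iota> b) 1
        | \<iota> a b. \<iota> \<in> K}
     \<union> {Poly_Mapping.single (\<iota> (s c a)) 1 - free_scale c (Poly_Mapping.single (\<iota> a) 1)
        | \<iota> c a. \<iota> \<in> K})"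

definition tensor_rel ::
    "('k::field \<Rightarrow> 'h::ab_group_add \<Rightarrow> 'h) \<Rightarrow> ('h \<Rightarrow> 'x) set \<Rightarrow> (('x \<Rightarrow>\<^sub>0 'k) \<times> ('x \<Rightarrow>\<^sub>0 'k)) set" where
  "tensor_rel s K = {(x, y). x - y \<in> multilinear_relations s K}"

type_synonym ('k, 'h) tensor2 = "('h \<times> 'h \<Rightarrow>\<^sub>0 'k) set"
type_synonym ('k, 'h) tensor3 = "('h \<times> 'h \<times> 'h \<Rightarrow>\<^sub>0 'k) set"

definition tensor_space2 ::
    "('k::field \<Rightarrow> 'h::ab_group_add \<Rightarrow> 'h) \<Rightarrow> ('k, 'h) tensor2 set" where
  "tensor_space2 s = UNIV // tensor_rel s slots2"

definition class2 ::
    "('k::field \<Rightarrow> 'h::ab_group_add \<Rightarrow> 'h) \<Rightarrow> ('h \<times> 'h \<Rightarrow>\<^sub>0 'k) \<Rightarrow> ('k, 'h) tensor2" where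
  "class2 s x = tensor_rel s slots2 `` {x}"

definition class3 ::
    "('k::field \<Rightarrow> 'h::ab_group_add \<Rightarrow> 'h) \<Rightarrow> ('h \<times> 'h \<times> 'h \<Rightarrow>\<^sub>0 'k) \<Rightarrow> ('k, 'h) tensor3" where
  "class3 s x = tensor_rel s slots3 `` {x}"

text \<open>
  Operations on tensors are defined on a chosen representative; each of them is compatible with
  the relations, so the choice does not matter.
\<close>

definition rep :: "('x \<Rightarrow>\<^sub>0 'k::zero) set \<Rightarrow> ('x \<Rightarrow>\<^sub>0 'k)" where
  "rep X = (SOME x. x \<in> X)"

definition pure2 ::
    "('k::field \<Rightarrow> 'h::ab_group_add \<Rightarrow> 'h) \<Rightarrow> 'h \<Rightarrow> 'h \<Rightarrow> ('k, 'h) tensor2" where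
  "pure2 s a b = class2 s (Poly_Mapping.single (a, b) 1)"

definition add2 ::
    "('k::field \<Rightarrow> 'h::ab_group_add \<Rightarrow> 'h) \<Rightarrow> ('k, 'h) tensor2 \<Rightarrow> ('k, 'h) tensor2 \<Rightarrow> ('k, 'h) tensor2"
  where "add2 s X Y = class2 s (rep X + rep Y)"

definition scale2 ::
    "('k::field \<Rightarrow> 'h::ab_group_add \<Rightarrow> 'h) \<Rightarrow> 'k \<Rightarrow> ('k, 'h) tensor2 \<Rightarrow> ('k, 'h) tensor2" where
  "scale2 s c X = class2 s (free_scale c (rep X))"

text \<open>
  The linear map out of a tensor power induced by a bilinear (trilinear) map \<open>f\<close> into a vector
  space with scalar multiplication \<open>sc\<close>.  In Sweedler notation,
  \<open>induced sc (\<lambda>(a, b). f a b) (\<Delta> h)\<close> is \<open>f h\<^sub>(\<^sub>1\<^sub>) h\<^sub>(\<^sub>2\<^sub>)\<close>.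
\<close>

definition induced ::
    "('k::field \<Rightarrow> 'w::comm_monoid_add \<Rightarrow> 'w) \<Rightarrow> ('x \<Rightarrow> 'w) \<Rightarrow> ('x \<Rightarrow>\<^sub>0 'k) set \<Rightarrow> 'w" where
  "induced sc f X = linear_extension sc f (rep X)"

definition free_mult :: "('x \<Rightarrow> 'x \<Rightarrow> 'x) \<Rightarrow> ('x \<Rightarrow>\<^sub>0 'k::field) \<Rightarrow> ('x \<Rightarrow>\<^sub>0 'k) \<Rightarrow> ('x \<Rightarrow>\<^sub>0 'k)" where
  "free_mult m x y = linear_extension free_scale
    (\<lambda>p. linear_extension free_scale (\<lambda>q. Poly_Mapping.single (m p q) 1) y) x"

definition mult2 ::
    "('k::field \<Rightarrow> 'h::ring \<Rightarrow> 'h) \<Rightarrow> ('k, 'h) tensor2 \<Rightarrow> ('k, 'h) tensor2 \<Rightarrow> ('k, 'h) tensor2" where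
  "mult2 s X Y = class2 s (free_mult (\<lambda>(a, b) (a', b'). (a * a', b * b')) (rep X) (rep Y))"

definition mult3 ::
    "('k::field \<Rightarrow> 'h::ring \<Rightarrow> 'h) \<Rightarrow> ('k, 'h) tensor3 \<Rightarrow> ('k, 'h) tensor3 \<Rightarrow> ('k, 'h) tensor3" where
  "mult3 s X Y =
    class3 s (free_mult (\<lambda>(a, b, c) (a', b', c'). (a * a', b * b', c * c')) (rep X) (rep Y))"

definition free_tensor_right :: "('h \<times> 'h \<Rightarrow>\<^sub>0 'k::field) \<Rightarrow> 'h \<Rightarrow> ('h \<times> 'h \<times> 'h \<Rightarrow>\<^sub>0 'k)" where
  "free_tensor_right x c = linear_extension free_scale (\<lambda>(a, b). Poly_Mapping.single (a, b, c) 1) x"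

definition free_tensor_left :: "'h \<Rightarrow> ('h \<times> 'h \<Rightarrow>\<^sub>0 'k::field) \<Rightarrow> ('h \<times> 'h \<times> 'h \<Rightarrow>\<^sub>0 'k)" where
  "free_tensor_left a x = linear_extension free_scale (\<lambda>(b, c). Poly_Mapping.single (a, b, c) 1) x"

text \<open>\<open>X \<otimes> c\<close> and \<open>a \<otimes> X\<close> in \<open>H \<otimes> H \<otimes> H\<close>, for a tensor \<open>X\<close> in \<open>H \<otimes> H\<close>.\<close>

definition tensor_right ::
    "('k::field \<Rightarrow> 'h::ab_group_add \<Rightarrow> 'h) \<Rightarrow> ('k, 'h) tensor2 \<Rightarrow> 'h \<Rightarrow> ('k, 'h) tensor3" where
  "tensor_right s X c = class3 s (free_tensor_right (rep X) c)"

definition tensor_left ::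
    "('k::field \<Rightarrow> 'h::ab_group_add \<Rightarrow> 'h) \<Rightarrow> 'h \<Rightarrow> ('k, 'h) tensor2 \<Rightarrow> ('k, 'h) tensor3" where
  "tensor_left s a X = class3 s (free_tensor_left a (rep X))"

text \<open>\<open>\<Delta> \<otimes> id\<close> and \<open>id \<otimes> \<Delta>\<close>, as maps from \<open>H \<otimes> H\<close> to \<open>H \<otimes> H \<otimes> H\<close>.\<close>

definition comult_id ::
    "('k::field \<Rightarrow> 'h::ab_group_add \<Rightarrow> 'h) \<Rightarrow> ('h \<Rightarrow> ('k, 'h) tensor2)
      \<Rightarrow> ('k, 'h) tensor2 \<Rightarrow> ('k, 'h) tensor3" where
  "comult_id s \<Delta> X =
    class3 s (linear_extension free_scale (\<lambda>(a, b). free_tensor_right (rep (\<Delta> a)) b) (rep X))"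

definition id_comult ::
    "('k::field \<Rightarrow> 'h::ab_group_add \<Rightarrow> 'h) \<Rightarrow> ('h \<Rightarrow> ('k, 'h) tensor2)
      \<Rightarrow> ('k, 'h) tensor2 \<Rightarrow> ('k, 'h) tensor3" where
  "id_comult s \<Delta> X =
    class3 s (linear_extension free_scale (\<lambda>(a, b). free_tensor_left a (rep (\<Delta> b))) (rep X))"


section \<open>Weak Hopf algebras\<close>

text \<open>
  The sort \<open>{ring, monoid_mult}\<close> is used instead of \<open>ring_1\<close> because the latter imposes
  \<open>0 \<noteq> 1\<close> and so would exclude the zero algebra.
\<close>

locale weak_hopf_algebra = vector_space scale
  for scale :: "'k::field \<Rightarrow> 'h::{ring,monoid_mult} \<Rightarrow> 'h" +
  fixes \<Delta> :: "'h \<Rightarrow> ('k, 'h) tensor2"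
    and \<epsilon> :: "'h \<Rightarrow> 'k"
    and S :: "'h \<Rightarrow> 'h"
  assumes scale_mult_left: "scale c a * b = scale c (a * b)"
    and scale_mult_right: "a * scale c b = scale c (a * b)"
    and comult_closed: "\<Delta> h \<in> tensor_space2 scale"
    and comult_add: "\<Delta> (g + h) = add2 scale (\<Delta> g) (\<Delta> h)"
    and comult_scale: "\<Delta> (scale c h) = scale2 scale c (\<Delta> h)"
    and counit_linear: "Vector_Spaces.linear scale (*) \<epsilon>"
    and antipode_linear: "Vector_Spaces.linear scale scale S"
    and coassoc: "comult_id scale \<Delta> (\<Delta> h) = id_comult scale \<Delta> (\<Delta> h)"
    and counit_left: "induced scale (\<lambda>(a, b). scale (\<epsilon> a) b) (\<Delta> h) = h"
    and counit_right: "induced scale (\<lambda>(a, b). scale (\<epsilon> b) a) (\<Delta> h) = h"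
    and comult_mult: "\<Delta> (h * g) = mult2 scale (\<Delta> h) (\<Delta> g)"
    and comult_one1: "comult_id scale \<Delta> (\<Delta> 1)
      = mult3 scale (tensor_right scale (\<Delta> 1) 1) (tensor_left scale 1 (\<Delta> 1))"
    and comult_one2: "comult_id scale \<Delta> (\<Delta> 1)
      = mult3 scale (tensor_left scale 1 (\<Delta> 1)) (tensor_right scale (\<Delta> 1) 1)"
    and counit_mult1: "\<epsilon> (f * g * h) = induced (*) (\<lambda>(a, b). \<epsilon> (f * a) * \<epsilon> (b * h)) (\<Delta> g)"
    and counit_mult2: "\<epsilon> (f * g * h) = induced (*) (\<lambda>(a, b). \<epsilon> (f * b) * \<epsilon> (a * h)) (\<Delta> g)"
    and antipode_right: "induced scale (\<lambda>(a, b). a * S b) (\<Delta> h)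
      = induced scale (\<lambda>(a, b). scale (\<epsilon> a) b) (mult2 scale (\<Delta> 1) (pure2 scale h 1))"
    and antipode_left: "induced scale (\<lambda>(a, b). S a * b) (\<Delta> h)
      = induced scale (\<lambda>(a, b). scale (\<epsilon> b) a) (mult2 scale (pure2 scale 1 h) (\<Delta> 1))"
    and antipode: "S h = induced scale (\<lambda>(a, b, c). S a * b * S c) (comult_id scale \<Delta> (\<Delta> h))"


section \<open>Group-like elements\<close>

definition source_counital ::
    "('k::field \<Rightarrow> 'h::{ring,monoid_mult} \<Rightarrow> 'h) \<Rightarrow> ('h \<Rightarrow> ('k, 'h) tensor2) \<Rightarrow> ('h \<Rightarrow> 'k) \<Rightarrow> 'h \<Rightarrow> 'h"
  where "source_counital s \<Delta> \<epsilon> h = induced s (\<lambda>(a, b). s (\<epsilon> (h * b)) a) (\<Delta> 1)"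

definition source_base ::
    "('k::field \<Rightarrow> 'h::{ring,monoid_mult} \<Rightarrow> 'h) \<Rightarrow> ('h \<Rightarrow> ('k, 'h) tensor2) \<Rightarrow> ('h \<Rightarrow> 'k) \<Rightarrow> 'h set"
  where "source_base s \<Delta> \<epsilon> = range (source_counital s \<Delta> \<epsilon>)"

definition mult_inverses :: "'h::monoid_mult \<Rightarrow> 'h \<Rightarrow> bool" where
  "mult_inverses g g' \<longleftrightarrow> g * g' = 1 \<and> g' * g = 1"

definition group_like ::
    "('k::field \<Rightarrow> 'h::{ring,monoid_mult} \<Rightarrow> 'h) \<Rightarrow> ('h \<Rightarrow> ('k, 'h) tensor2) \<Rightarrow> 'h \<Rightarrow> bool" where
  "group_like s \<Delta> g \<longleftrightarrow> (\<exists>g'. mult_inverses g g')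
    \<and> \<Delta> g = mult2 s (pure2 s g g) (\<Delta> 1)
    \<and> \<Delta> g = mult2 s (\<Delta> 1) (pure2 s g g)"

definition group_like_group ::
    "('k::field \<Rightarrow> 'h::{ring,monoid_mult} \<Rightarrow> 'h) \<Rightarrow> ('h \<Rightarrow> ('k, 'h) tensor2) \<Rightarrow> 'h monoid" where
  "group_like_group s \<Delta> = \<lparr>carrier = {g. group_like s \<Delta> g}, mult = (*), one = 1\<rparr>"

text \<open>
  Invertibility of \<open>y\<close> is meant in \<open>H\<close>; for finite-dimensional \<open>H\<close> the inverse of an element of the
  unital subalgebra \<open>H\<^sub>s\<close> lies in \<open>H\<^sub>s\<close> again.
\<close>

definition trivial_group_likes ::
    "('k::field \<Rightarrow> 'h::{ring,monoid_mult} \<Rightarrow> 'h) \<Rightarrow> ('h \<Rightarrow> ('k, 'h) tensor2) \<Rightarrow> ('h \<Rightarrow> 'k) \<Rightarrow> ('h \<Rightarrow> 'h)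
      \<Rightarrow> 'h set" where
  "trivial_group_likes s \<Delta> \<epsilon> S =
    {g. group_like s \<Delta> g \<and> (\<exists>y y'. y \<in> source_base s \<Delta> \<epsilon> \<and> mult_inverses y y' \<and> g = S y * y')}"

end

theory Submission
  imports Defs
begin

text \<open>
  Write \<open>H\<^sub>s\<close> and \<open>H\<^sub>t\<close> for the source and target counital subalgebras; they commute, and
  \<open>\<Delta> 1 = \<Sum>i. u i \<otimes> v i\<close> with \<open>u i \<in> H\<^sub>s\<close> and \<open>v i \<in> H\<^sub>t\<close>.  For a group-like element \<open>g\<close> and \<open>z \<in> H\<^sub>t\<close>
  one has \<open>\<Delta> (g * z) = \<Sum>i. g * z * u i \<otimes> g * v i\<close>.  Hence \<open>g H\<^sub>t\<close> is a left coideal of \<open>H\<close>: a functional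
  \<open>\<phi>\<close> on \<open>H\<close> acts on it by \<open>g * z \<mapsto> g * (\<Sum>i. \<phi> (g * z * u i) v i)\<close>.

  Colinear maps \<open>h H\<^sub>t \<rightarrow> g H\<^sub>t\<close> are right multiplications by elements of \<open>H\<^sub>s\<close>.  So \<open>g H\<^sub>t\<close> and \<open>h H\<^sub>t\<close> are
  isomorphic exactly when \<open>g * z = h * y\<close> for invertible \<open>z \<in> H\<^sub>t\<close> and \<open>y \<in> H\<^sub>s\<close>, that is, when \<open>h\<inverse> * g\<close> is a
  product \<open>y * z\<inverse>\<close>.  A group-like element of this form is trivial, because its image under the
  target counital map is \<open>1\<close>, which forces \<open>z = S y\<close> (lemma \<open>trivial_group_likeI\<close>).  Therefore it
  is enough to show that the coideals \<open>g H\<^sub>t\<close> fall into finitely many isomorphism classes.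

  This follows from semisimplicity.  If \<open>e\<close> is a primitive idempotent of the commutative algebra
  \<open>H\<^sub>s \<inter> H\<^sub>t\<close>, then \<open>y * z \<noteq> 0\<close> for all nonzero \<open>y \<in> e H\<^sub>s\<close> and \<open>z \<in> e H\<^sub>t\<close> (lemma
  \<open>primitive_no_zero_divisors\<close>).  The proof uses that \<open>H\<^sub>s\<close> is separable, so that the annihilator of
  \<open>z\<close> is generated by a central idempotent \<open>j\<close>, and the antipode, which gives \<open>j \<in> H\<^sub>t\<close>.  By duality
  the coideals \<open>g e H\<^sub>t\<close> are simple (lemma \<open>primitive_slices\<close>).  Pairwise non-isomorphic simple
  coideals of \<open>H\<close> have a direct sum, so that at most \<open>dim H\<close> isomorphism classes of coideals \<open>g e H\<^sub>t\<close>
  occur for a given \<open>e\<close>.  An idempotent that is not primitive is a sum of two smaller orthogonal ones,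
  and isomorphisms over the summands add up to an isomorphism over the sum; by induction on the
  dimension there are finitely many classes for every idempotent of \<open>H\<^sub>s \<inter> H\<^sub>t\<close>, in particular for \<open>1\<close>.

  The relation \<open>related_over e g h\<close> expresses in terms of elements that \<open>g e H\<^sub>t\<close> and \<open>h e H\<^sub>t\<close> are
  isomorphic.  It controls left cosets of the trivial group-like elements; taking inverses gives the
  right cosets that make up the quotient.
\<close>

section \<open>Functionals and evaluation of tensors\<close>

lemma (in vector_space) separating_functional:
  assumes V: "subspace V" and v: "v \<notin> V"
  shows "\<exists>\<phi>. Vector_Spaces.linear scale (*) \<phi> \<and> (\<forall>x\<in>V. \<phi> x = 0) \<and> \<phi> v = 1"
proof -
  interpret K: vector_space "(*) :: 'a \<Rightarrow> 'a \<Rightarrow> 'a"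
    by unfold_locales (auto simp: algebra_simps)
  interpret vector_space_pair scale "(*) :: 'a \<Rightarrow> 'a \<Rightarrow> 'a" ..
  obtain B where B: "B \<subseteq> V" "independent B" "V \<subseteq> span B"
    using basis_exists[of V] by metis
  have sp: "span B = V" using B V by (metis span_minimal subset_antisym)
  have "independent (insert v B)"
    using B v sp by (simp add: independent_insert)
  then obtain \<phi> where \<phi>: "Vector_Spaces.linear scale (*) \<phi>"
    "\<forall>x\<in>insert v B. \<phi> x = (if x = v then 1 else 0)"
    using linear_independent_extend[of "insert v B" "\<lambda>x. if x = v then 1 else 0"] by blast
  have "\<phi> x = 0" if "x \<in> V" for x
  proof (rule linear_eq_0_on_span[OF \<phi>(1), of B])
    show "x \<in> span B" using that sp by simp
    show "\<phi> b = 0" if "b \<in> B" for b using that \<phi>(2) v B(1) by auto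
  qed
  then show ?thesis using \<phi> by auto
qed

lemma lookup_free_scale [simp]:
  "Poly_Mapping.lookup (free_scale c x) p = c * Poly_Mapping.lookup x p"
  unfolding free_scale_def by (simp add: Poly_Mapping.map.rep_eq when_def)

interpretation free: vector_space "free_scale :: 'k::field \<Rightarrow> ('x \<Rightarrow>\<^sub>0 'k) \<Rightarrow> ('x \<Rightarrow>\<^sub>0 'k)"
  by unfold_locales (auto intro!: poly_mapping_eqI simp: lookup_add algebra_simps)

lemma free_scale_single [simp]:
  "free_scale c (Poly_Mapping.single p d) = Poly_Mapping.single p (c * d)"
  by (rule poly_mapping_eqI) (simp add: lookup_single when_def)

context vector_space
begin

lemma linear_extension_superset:
  assumes "finite A" "Poly_Mapping.keys x \<subseteq> A"
  shows "linear_extension scale f x = (\<Sum>p\<in>A. scale (Poly_Mapping.lookup x p) (f p))"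
  unfolding linear_extension_def
  by (rule sum.mono_neutral_left) (use assms in \<open>auto simp: in_keys_iff\<close>)

lemma linear_linear_extension:
  "Vector_Spaces.linear free_scale scale (linear_extension scale f)"
proof (unfold_locales)
  fix x y :: "'c \<Rightarrow>\<^sub>0 'a" and c :: 'a
  let ?A = "Poly_Mapping.keys x \<union> Poly_Mapping.keys y"
  have A: "finite ?A" "Poly_Mapping.keys (x + y) \<subseteq> ?A"
    by (simp_all add: Poly_Mapping.keys_add)
  have "Poly_Mapping.keys (free_scale c x) \<subseteq> ?A"
    by (auto simp: in_keys_iff)
  then show "linear_extension scale f (free_scale c x) = scale c (linear_extension scale f x)"
    using A(1) by (simp add: linear_extension_superset[of ?A] scale_sum_right)
  show "linear_extension scale f (x + y) = linear_extension scale f x + linear_extension scale f y"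
    using A by (simp add: linear_extension_superset[of ?A] lookup_add scale_left_distrib sum.distrib)
qed

lemma linear_extension_single [simp]:
  "linear_extension scale f (Poly_Mapping.single p c) = scale c (f p)"
  by (cases "c = 0") (simp_all add: linear_extension_def)

end

lemma (in vector_space) linear_on_linear_extension:
  assumes "Vector_Spaces.linear free_scale scale F"
  shows "F (linear_extension free_scale g x) = linear_extension scale (\<lambda>p. F (g p)) x"
proof -
  interpret F: Vector_Spaces.linear free_scale scale F by fact
  show ?thesis unfolding linear_extension_def by (simp add: F.sum F.scale)
qed

lemma linear_extension_id:
  "linear_extension free_scale (\<lambda>p. Poly_Mapping.single p 1) x = x"
  by (rule poly_mapping_eqI)
    (auto simp: linear_extension_def lookup_sum lookup_single when_def in_keys_iff sum.delta)

lemma (in vector_space) linear_free_eq_linear_extension: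
  assumes "Vector_Spaces.linear free_scale scale F"
  shows "F x = linear_extension scale (\<lambda>p. F (Poly_Mapping.single p 1)) x"
  using linear_on_linear_extension[OF assms, of "\<lambda>p. Poly_Mapping.single p 1" x]
  by (simp add: linear_extension_id)

text \<open>
  The family \<open>K\<close> of slots is a parameter so that bilinear and trilinear maps are treated at once.
\<close>

definition multilinear ::
    "('k::field \<Rightarrow> 'h::ab_group_add \<Rightarrow> 'h) \<Rightarrow> ('k \<Rightarrow> 'w::ab_group_add \<Rightarrow> 'w) \<Rightarrow> ('h \<Rightarrow> 'x) set
      \<Rightarrow> ('x \<Rightarrow> 'w) \<Rightarrow> bool" where
  "multilinear s sc K f \<longleftrightarrow> (\<forall>\<iota>\<in>K. \<forall>a b. f (\<iota> (a + b)) = f (\<iota> a) + f (\<iota> b))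
    \<and> (\<forall>\<iota>\<in>K. \<forall>c a. f (\<iota> (s c a)) = sc c (f (\<iota> a)))"

lemma linear_extension_relations:
  assumes sc: "vector_space sc" and f: "multilinear s sc K f"
    and x: "x \<in> multilinear_relations s K"
  shows "linear_extension sc f x = 0"
proof -
  interpret W: vector_space sc by fact
  interpret vector_space_pair free_scale sc ..
  interpret L: Vector_Spaces.linear free_scale sc "linear_extension sc f"
    by (rule W.linear_linear_extension)
  show ?thesis
    using x unfolding multilinear_relations_def
  proof (rule linear_eq_0_on_span[OF L.linear_axioms, rotated])
  qed (use f in \<open>auto simp: multilinear_def L.diff\<close>)
qed

lemma multilinear_relations_zero: "0 \<in> multilinear_relations s K"
  unfolding multilinear_relations_def by (rule free.span_zero)

lemma rep_tensor_class: "x - rep (tensor_rel s K `` {x}) \<in> multilinear_relations s K"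
proof -
  have "x \<in> tensor_rel s K `` {x}"
    by (simp add: tensor_rel_def multilinear_relations_zero)
  then have "rep (tensor_rel s K `` {x}) \<in> tensor_rel s K `` {x}"
    unfolding rep_def by (rule someI)
  then show ?thesis by (simp add: tensor_rel_def)
qed

text \<open>
  The linear extension of a multilinear map vanishes on the relations, so its value on a tensor does not
  depend on the representative.
\<close>

lemma linear_extension_rep:
  assumes sc: "vector_space sc" and f: "multilinear s sc K f"
  shows "linear_extension sc f (rep (tensor_rel s K `` {x})) = linear_extension sc f x"
proof -
  interpret W: vector_space sc by fact
  interpret L: Vector_Spaces.linear free_scale sc "linear_extension sc f"
    by (rule W.linear_linear_extension)
  show ?thesis
    using linear_extension_relations[OF sc f rep_tensor_class[of x s K]] by (simp add: L.diff)
qed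

text \<open>
  Multilinear functionals separate tensors: a functional on the free vector space that vanishes on the
  relations is the linear extension of a multilinear one.  This reduces every identity between tensors
  to an identity of evaluations.
\<close>

lemma tensor_class_eqI:
  fixes s :: "'k::field \<Rightarrow> 'h::ab_group_add \<Rightarrow> 'h"
  assumes "\<And>f :: 'x \<Rightarrow> 'k. multilinear s (*) K f \<Longrightarrow>
    linear_extension (*) f x = linear_extension (*) f y"
  shows "tensor_rel s K `` {x} = tensor_rel s K `` {y}"
proof -
  interpret K: vector_space "(*) :: 'k \<Rightarrow> 'k \<Rightarrow> 'k"
    by unfold_locales (auto simp: algebra_simps)
  let ?R = "multilinear_relations s K"
  have sub: "free.subspace ?R"
    unfolding multilinear_relations_def by (rule free.subspace_span)
  have xy: "x - y \<in> ?R"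
  proof (rule ccontr)
    assume "x - y \<notin> ?R"
    then obtain F where F: "Vector_Spaces.linear free_scale (*) F"
        and F0: "\<forall>r\<in>?R. F r = 0" and F1: "F (x - y) = 1"
      using free.separating_functional[OF sub] by blast
    interpret F: Vector_Spaces.linear free_scale "(*)" F by fact
    define f where "f p = F (Poly_Mapping.single p 1)" for p
    have base: "r \<in> ?R" if "r \<in> {Poly_Mapping.single (\<iota> (a + b)) 1 - Poly_Mapping.single (\<iota> a) 1
          - Poly_Mapping.single (\<iota> b) 1 | \<iota> a b. \<iota> \<in> K}
     \<union> {Poly_Mapping.single (\<iota> (s c a)) 1 - free_scale c (Poly_Mapping.single (\<iota> a) 1)
        | \<iota> c a. \<iota> \<in> K}" for r
      using that unfolding multilinear_relations_def by (rule free.span_base)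
    have "f (\<iota> (a + b)) = f (\<iota> a) + f (\<iota> b)" if "\<iota> \<in> K" for \<iota> a b
    proof -
      have "F (Poly_Mapping.single (\<iota> (a + b)) 1 - Poly_Mapping.single (\<iota> a) 1
          - Poly_Mapping.single (\<iota> b) 1) = 0"
        by (rule F0[rule_format], rule base) (use that in blast)
      then show ?thesis unfolding F.diff f_def by (simp add: algebra_simps)
    qed
    moreover have "f (\<iota> (s c a)) = c * f (\<iota> a)" if "\<iota> \<in> K" for \<iota> c a
    proof -
      have "F (Poly_Mapping.single (\<iota> (s c a)) 1 - free_scale c (Poly_Mapping.single (\<iota> a) 1)) = 0"
        by (rule F0[rule_format], rule base) (use that in blast)
      then show ?thesis unfolding F.diff F.scale f_def by simp
    qed
    ultimately have "multilinear s (*) K f" by (simp add: multilinear_def)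
    then have "linear_extension (*) f x = linear_extension (*) f y" by (rule assms)
    then have "F x = F y"
      unfolding f_def K.linear_free_eq_linear_extension[OF F, symmetric] .
    then show False using F1 by (simp add: F.diff)
  qed
  have "x - z \<in> ?R \<longleftrightarrow> y - z \<in> ?R" for z
    using free.subspace_diff[OF sub _ xy, of "x - z"] free.subspace_add[OF sub _ xy, of "y - z"]
    by auto
  then show ?thesis by (auto simp: tensor_rel_def)
qed

lemma linear_extension_free_mult:
  assumes "vector_space sc"
  shows "linear_extension sc f (free_mult m x y)
    = linear_extension sc (\<lambda>p. linear_extension sc (\<lambda>q. f (m p q)) y) x"
proof -
  interpret W: vector_space sc by fact
  show ?thesis unfolding free_mult_def
    by (simp add: W.linear_on_linear_extension[OF W.linear_linear_extension])
qed

section \<open>Evaluation of the comultiplication\<close>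

context weak_hopf_algebra
begin

definition bilinear :: "('k \<Rightarrow> 'w::ab_group_add \<Rightarrow> 'w) \<Rightarrow> ('h \<Rightarrow> 'h \<Rightarrow> 'w) \<Rightarrow> bool" where
  "bilinear sc f \<longleftrightarrow> (\<forall>x x' y. f (x + x') y = f x y + f x' y) \<and> (\<forall>c x y. f (scale c x) y = sc c (f x y))
    \<and> (\<forall>x y y'. f x (y + y') = f x y + f x y') \<and> (\<forall>c x y. f x (scale c y) = sc c (f x y))"

definition trilinear :: "('k \<Rightarrow> 'w::ab_group_add \<Rightarrow> 'w) \<Rightarrow> ('h \<Rightarrow> 'h \<Rightarrow> 'h \<Rightarrow> 'w) \<Rightarrow> bool" where
  "trilinear sc f \<longleftrightarrow> (\<forall>y. bilinear sc (\<lambda>x z. f x y z)) \<and> (\<forall>x. bilinear sc (f x))"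

text \<open>
  In Sweedler notation, \<open>sweedler sc f h\<close> is \<open>f h\<^sub>(\<^sub>1\<^sub>) h\<^sub>(\<^sub>2\<^sub>)\<close>.
\<close>

definition sweedler :: "('k \<Rightarrow> 'w::ab_group_add \<Rightarrow> 'w) \<Rightarrow> ('h \<Rightarrow> 'h \<Rightarrow> 'w) \<Rightarrow> 'h \<Rightarrow> 'w" where
  "sweedler sc f h = induced sc (\<lambda>(a, b). f a b) (\<Delta> h)"

lemma bilinear_iff_multilinear: "bilinear sc f \<longleftrightarrow> multilinear scale sc slots2 (\<lambda>(a, b). f a b)"
  unfolding bilinear_def multilinear_def slots2_def
  by (simp add: ball_Un imp_ex all_conj_distrib) (blast)

lemma trilinear_iff_multilinear:
  "trilinear sc f \<longleftrightarrow> multilinear scale sc slots3 (\<lambda>(a, b, c). f a b c)"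
  unfolding trilinear_def bilinear_def multilinear_def slots3_def
  by (simp add: ball_Un imp_ex all_conj_distrib) (intro iffI conjI allI; simp)

lemma linear_mult_left: "Vector_Spaces.linear scale scale (\<lambda>x. c * x)"
  by unfold_locales (simp_all add: algebra_simps scale_mult_right)

lemma counit_add: "\<epsilon> (x + y) = \<epsilon> x + \<epsilon> y" and counit_scale: "\<epsilon> (scale c x) = c * \<epsilon> x"
  using counit_linear by (simp_all add: Vector_Spaces.linear_iff)

lemma antipode_add: "S (x + y) = S x + S y" and antipode_scale: "S (scale c x) = scale c (S x)"
  using antipode_linear by (simp_all add: Vector_Spaces.linear_iff)

lemma counit_sum: "\<epsilon> (sum f A) = (\<Sum>i\<in>A. \<epsilon> (f i))"
proof -
  interpret E: Vector_Spaces.linear scale "(*)" \<epsilon> by (rule counit_linear)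
  show ?thesis by (rule E.sum)
qed

lemmas multilinear_simps = bilinear_def trilinear_def counit_add counit_scale antipode_add
  antipode_scale scale_mult_left scale_mult_right distrib_left distrib_right
  scale_left_distrib scale_right_distrib

lemma rep_comult: "tensor_rel scale slots2 `` {rep (\<Delta> h)} = \<Delta> h"
proof -
  have "equiv UNIV (tensor_rel scale (slots2 :: ('h \<Rightarrow> 'h \<times> 'h) set))"
  proof (rule equivI)
    let ?R = "multilinear_relations scale (slots2 :: ('h \<Rightarrow> 'h \<times> 'h) set)"
    have sub: "free.subspace ?R"
      unfolding multilinear_relations_def by (rule free.subspace_span)
    show "sym (tensor_rel scale (slots2 :: ('h \<Rightarrow> 'h \<times> 'h) set))"
      using free.subspace_neg[OF sub] by (fastforce simp: sym_def tensor_rel_def)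
    show "refl_on UNIV (tensor_rel scale (slots2 :: ('h \<Rightarrow> 'h \<times> 'h) set))"
      by (simp add: refl_on_def tensor_rel_def multilinear_relations_zero)
    show "trans (tensor_rel scale (slots2 :: ('h \<Rightarrow> 'h \<times> 'h) set))"
      using free.subspace_add[OF sub] by (fastforce simp: trans_def tensor_rel_def)
  qed simp
  moreover obtain x where x: "\<Delta> h = tensor_rel scale slots2 `` {x}"
    using comult_closed[of h] by (auto simp: tensor_space2_def quotient_def)
  moreover have "(x, rep (\<Delta> h)) \<in> tensor_rel scale slots2"
    using rep_tensor_class[of x scale slots2] by (simp only: x tensor_rel_def mem_Collect_eq case_prod_conv)
  ultimately show ?thesis by (simp add: equiv_class_eq)
qed

lemma induced_class2:
  assumes "vector_space sc" "bilinear sc f"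
  shows "induced sc (\<lambda>(a, b). f a b) (class2 scale x) = linear_extension sc (\<lambda>(a, b). f a b) x"
  using assms linear_extension_rep unfolding induced_def class2_def bilinear_iff_multilinear by blast

lemma induced_class3:
  assumes "vector_space sc" "trilinear sc f"
  shows "induced sc (\<lambda>(a, b, c). f a b c) (class3 scale x)
    = linear_extension sc (\<lambda>(a, b, c). f a b c) x"
  using assms linear_extension_rep unfolding induced_def class3_def trilinear_iff_multilinear by blast

lemma sweedler_eq: "sweedler sc f h = linear_extension sc (\<lambda>(a, b). f a b) (rep (\<Delta> h))"
  by (simp add: sweedler_def induced_def)

text \<open>
  The form in which \<open>tensor_class_eqI\<close> verifies that an element is group-like.
\<close>

lemma comult_eqI:
  assumes "\<And>f :: 'h \<Rightarrow> 'h \<Rightarrow> 'k. bilinear (*) f \<Longrightarrow>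
    sweedler (*) f h = linear_extension (*) (\<lambda>(a, b). f a b) x"
  shows "\<Delta> h = class2 scale x"
proof -
  have "tensor_rel scale slots2 `` {rep (\<Delta> h)} = tensor_rel scale slots2 `` {x}"
  proof (rule tensor_class_eqI)
    fix f :: "'h \<times> 'h \<Rightarrow> 'k" assume "multilinear scale (*) slots2 f"
    then show "linear_extension (*) f (rep (\<Delta> h)) = linear_extension (*) f x"
      using assms[of "\<lambda>a b. f (a, b)"] by (simp add: bilinear_iff_multilinear sweedler_eq)
  qed
  then show ?thesis by (simp add: rep_comult class2_def)
qed

end

text \<open>
  The vector space \<open>'w\<close> receives the values of the multilinear maps at which tensors are evaluated.  It is
  used with \<open>'w\<close> equal to \<open>H\<close> and with \<open>'w\<close> equal to the ground field.
\<close>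

locale weak_hopf_algebra_eval = weak_hopf_algebra scale \<Delta> \<epsilon> S + W: vector_space sc
  for scale :: "'k::field \<Rightarrow> 'h::{ring,monoid_mult} \<Rightarrow> 'h" and \<Delta> \<epsilon> S
    and sc :: "'k \<Rightarrow> 'w::ab_group_add \<Rightarrow> 'w"
begin

lemma linear_sweedler:
  assumes "bilinear sc f"
  shows "Vector_Spaces.linear scale sc (sweedler sc f)"
proof -
  interpret L: Vector_Spaces.linear free_scale sc "linear_extension sc (\<lambda>(a, b). f a b)"
    by (rule W.linear_linear_extension)
  show ?thesis
  proof unfold_locales
    fix x y c
    show "sweedler sc f (x + y) = sweedler sc f x + sweedler sc f y"
      unfolding sweedler_def[of _ _ "x + y"] comult_add add2_def
        induced_class2[OF W.vector_space_axioms assms] by (simp add: sweedler_eq L.add)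
    show "sweedler sc f (scale c x) = sc c (sweedler sc f x)"
      unfolding sweedler_def[of _ _ "scale c x"] comult_scale scale2_def
        induced_class2[OF W.vector_space_axioms assms] by (simp add: sweedler_eq L.scale)
  qed
qed

lemma sweedler_plus: "sweedler sc (\<lambda>a b. f a b + g a b) h = sweedler sc f h + sweedler sc g h"
  by (simp add: sweedler_eq linear_extension_def case_prod_unfold W.scale_right_distrib sum.distrib)

lemma sweedler_scaled: "sweedler sc (\<lambda>a b. sc c (f a b)) h = sc c (sweedler sc f h)"
  by (simp add: sweedler_eq linear_extension_def case_prod_unfold W.scale_sum_right mult.commute)

lemma sweedler_mult:
  assumes "bilinear sc f"
  shows "sweedler sc f (g * h) = sweedler sc (\<lambda>a b. sweedler sc (\<lambda>a' b'. f (a * a') (b * b')) h) g"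
  unfolding sweedler_def[of _ _ "g * h"] comult_mult mult2_def
    induced_class2[OF W.vector_space_axioms assms]
  by (simp add: linear_extension_free_mult[OF W.vector_space_axioms] sweedler_eq case_prod_unfold)

lemma bilinear_sweedler_mult:
  assumes f: "bilinear sc f"
  shows "bilinear sc (\<lambda>a b. sweedler sc (\<lambda>a' b'. f (a * a') (b * b')) h)"
proof -
  have "(\<lambda>a' b'. f (a * a') ((b + d) * b')) = (\<lambda>a' b'. f (a * a') (b * b') + f (a * a') (d * b'))"
    "(\<lambda>a' b'. f ((a + d) * a') (b * b')) = (\<lambda>a' b'. f (a * a') (b * b') + f (d * a') (b * b'))"
    "(\<lambda>a' b'. f (a * a') (scale c b * b')) = (\<lambda>a' b'. sc c (f (a * a') (b * b')))"
    "(\<lambda>a' b'. f (scale c a * a') (b * b')) = (\<lambda>a' b'. sc c (f (a * a') (b * b')))" for a b c d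
    using f by (simp_all add: fun_eq_iff multilinear_simps)
  then show ?thesis by (simp add: bilinear_def sweedler_plus sweedler_scaled)
qed

lemma eval_comult_id:
  assumes "trilinear sc f"
  shows "induced sc (\<lambda>(a, b, c). f a b c) (comult_id scale \<Delta> (\<Delta> h))
    = sweedler sc (\<lambda>a c. sweedler sc (\<lambda>x y. f x y c) a) h"
  unfolding comult_id_def induced_class3[OF W.vector_space_axioms assms]
  by (simp add: W.linear_on_linear_extension[OF W.linear_linear_extension]
     free_tensor_right_def sweedler_eq case_prod_unfold)

lemma eval_id_comult:
  assumes "trilinear sc f"
  shows "induced sc (\<lambda>(a, b, c). f a b c) (id_comult scale \<Delta> (\<Delta> h))
    = sweedler sc (\<lambda>a c. sweedler sc (\<lambda>x y. f a x y) c) h"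
  unfolding id_comult_def induced_class3[OF W.vector_space_axioms assms]
  by (simp add: W.linear_on_linear_extension[OF W.linear_linear_extension]
     free_tensor_left_def sweedler_eq case_prod_unfold)

lemma eval_mult3:
  assumes f: "trilinear sc f"
  shows "induced sc (\<lambda>(a, b, c). f a b c) (mult3 scale (class3 scale x) (class3 scale y))
    = linear_extension sc (\<lambda>(a, b, c). linear_extension sc
        (\<lambda>(a', b', c'). f (a * a') (b * b') (c * c')) y) x"
proof -
  let ?L = "\<lambda>y (a, b, c). linear_extension sc (\<lambda>(a', b', c'). f (a * a') (b * b') (c * c')) y"
  have in1: "trilinear sc (\<lambda>a' b' c'. f (a * a') (b * b') (c * c'))" for a b c
    using f by (simp add: multilinear_simps)
  have in2: "trilinear sc (\<lambda>a b c. ?L y (a, b, c))" for y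
    using f
    by (simp add: multilinear_simps linear_extension_def case_prod_unfold sum.distrib W.scale_sum_right
       W.scale_right_distrib mult.commute)
  have "induced sc (\<lambda>(a, b, c). f a b c) (mult3 scale (class3 scale x) (class3 scale y))
    = linear_extension sc (?L (rep (class3 scale y))) (rep (class3 scale x))"
    unfolding mult3_def induced_class3[OF W.vector_space_axioms f]
    by (simp add: linear_extension_free_mult[OF W.vector_space_axioms] case_prod_unfold)
  also have "?L (rep (class3 scale y)) = ?L y"
    using in1 linear_extension_rep[OF W.vector_space_axioms, of scale slots3]
    by (auto simp: fun_eq_iff class3_def trilinear_iff_multilinear)
  also have "linear_extension sc (?L y) (rep (class3 scale x)) = linear_extension sc (?L y) x"
    using in2[of y] linear_extension_rep[OF W.vector_space_axioms, of scale slots3]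
    by (auto simp: class3_def trilinear_iff_multilinear)
  finally show ?thesis .
qed

lemma eval_mult2:
  assumes f: "bilinear sc f"
  shows "induced sc (\<lambda>(a, b). f a b) (mult2 scale (class2 scale x) (class2 scale y))
    = linear_extension sc (\<lambda>(a, b). linear_extension sc
        (\<lambda>(a', b'). f (a * a') (b * b')) y) x"
proof -
  let ?L = "\<lambda>y (a, b). linear_extension sc (\<lambda>(a', b'). f (a * a') (b * b')) y"
  have in1: "bilinear sc (\<lambda>a' b'. f (a * a') (b * b'))" for a b
    using f by (simp add: multilinear_simps)
  have in2: "bilinear sc (\<lambda>a b. ?L y (a, b))" for y
    using f
    by (simp add: multilinear_simps linear_extension_def case_prod_unfold sum.distrib W.scale_sum_right
       W.scale_right_distrib mult.commute)
  have "induced sc (\<lambda>(a, b). f a b) (mult2 scale (class2 scale x) (class2 scale y))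
    = linear_extension sc (?L (rep (class2 scale y))) (rep (class2 scale x))"
    unfolding mult2_def induced_class2[OF W.vector_space_axioms f]
    by (simp add: linear_extension_free_mult[OF W.vector_space_axioms] case_prod_unfold)
  also have "?L (rep (class2 scale y)) = ?L y"
    using in1 linear_extension_rep[OF W.vector_space_axioms, of scale slots2]
    by (auto simp: fun_eq_iff class2_def bilinear_iff_multilinear)
  also have "linear_extension sc (?L y) (rep (class2 scale x)) = linear_extension sc (?L y) x"
    using in2[of y] linear_extension_rep[OF W.vector_space_axioms, of scale slots2]
    by (auto simp: class2_def bilinear_iff_multilinear)
  finally show ?thesis .
qed

lemma comult_class: "class2 scale (rep (\<Delta> h)) = \<Delta> h"
  by (simp add: class2_def rep_comult)

lemma eval_comult_mult_pure:
  assumes f: "bilinear sc f"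
  shows "induced sc (\<lambda>(a, b). f a b) (mult2 scale (\<Delta> h) (pure2 scale c d))
    = sweedler sc (\<lambda>a b. f (a * c) (b * d)) h"
  using eval_mult2[OF f, of "rep (\<Delta> h)" "Poly_Mapping.single (c, d) 1"]
  by (simp add: pure2_def sweedler_eq comult_class case_prod_unfold)

lemma eval_pure_mult_comult:
  assumes f: "bilinear sc f"
  shows "induced sc (\<lambda>(a, b). f a b) (mult2 scale (pure2 scale c d) (\<Delta> h))
    = sweedler sc (\<lambda>a b. f (c * a) (d * b)) h"
  using eval_mult2[OF f, of "Poly_Mapping.single (c, d) 1" "rep (\<Delta> h)"]
  by (simp add: pure2_def sweedler_eq comult_class case_prod_unfold)

end

context weak_hopf_algebra
begin

text \<open>
  The chosen representative of \<open>\<Delta> 1\<close> is written as \<open>\<Sum>i\<in>one_support. one1 i \<otimes> one2 i\<close>; the coefficients of the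
  formal sum are absorbed into the first leg.
\<close>

definition one_support :: "('h \<times> 'h) set" where
  "one_support = Poly_Mapping.keys (rep (\<Delta> 1))"

definition one1 :: "'h \<times> 'h \<Rightarrow> 'h" where
  "one1 i = scale (Poly_Mapping.lookup (rep (\<Delta> 1)) i) (fst i)"

definition one2 :: "'h \<times> 'h \<Rightarrow> 'h" where
  "one2 i = snd i"

lemma finite_one_support [simp]: "finite one_support"
  by (simp add: one_support_def)

end

context weak_hopf_algebra_eval
begin

lemma sweedler_one:
  assumes "bilinear sc f"
  shows "sweedler sc f 1 = (\<Sum>i\<in>one_support. f (one1 i) (one2 i))"
  using assms
  by (simp add: sweedler_eq linear_extension_def one_support_def one1_def one2_def bilinear_def
      case_prod_unfold)

lemma double_sum_one:
  "linear_extension sc (\<lambda>p. linear_extension sc (\<lambda>q. F p q) (rep (\<Delta> 1))) (rep (\<Delta> 1))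
    = sweedler sc (\<lambda>a b. sweedler sc (\<lambda>a' b'. F (a, b) (a', b')) 1) 1"
  by (simp add: sweedler_eq case_prod_unfold)

text \<open>
  The two formulas for \<open>(\<Delta> \<otimes> id) (\<Delta> 1)\<close> and coassociativity at \<open>1\<close>, evaluated at a trilinear map.  The structure
  of the counital subalgebras is derived from these three identities.
\<close>

lemma comult_id_one:
  assumes f: "trilinear sc f"
  shows "(\<Sum>i\<in>one_support. sweedler sc (\<lambda>x y. f x y (one2 i)) (one1 i))
      = (\<Sum>i\<in>one_support. \<Sum>j\<in>one_support. f (one1 i) (one2 i * one1 j) (one2 j))" (is "?A = ?B")
    and "(\<Sum>i\<in>one_support. sweedler sc (\<lambda>x y. f x y (one2 i)) (one1 i))
      = (\<Sum>i\<in>one_support. \<Sum>j\<in>one_support. f (one1 i) (one1 j * one2 i) (one2 j))" (is "_ = ?C")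
    and "(\<Sum>i\<in>one_support. sweedler sc (\<lambda>x y. f x y (one2 i)) (one1 i))
      = (\<Sum>i\<in>one_support. sweedler sc (\<lambda>x y. f (one1 i) x y) (one2 i))" (is "_ = ?D")
proof -
  note eqs = W.linear_on_linear_extension[OF W.linear_linear_extension]
  have lin: "Vector_Spaces.linear scale sc (sweedler sc (\<lambda>x y. f x y c))"
      "Vector_Spaces.linear scale sc (sweedler sc (\<lambda>x y. f c x y))" for c
    by (rule linear_sweedler, use f in \<open>simp add: multilinear_simps\<close>)+
  have bil: "bilinear sc (\<lambda>a c. sweedler sc (\<lambda>x y. f x y c) a)"
      "bilinear sc (\<lambda>a c. sweedler sc (\<lambda>x y. f a x y) c)"
  proof -
    have "f (x + x') = (\<lambda>a b. f x a b + f x' a b)" "f (scale c x) = (\<lambda>a b. sc c (f x a b))" for x x' c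
      using f by (simp_all add: fun_eq_iff multilinear_simps)
    then show "bilinear sc (\<lambda>a c. sweedler sc (\<lambda>x y. f a x y) c)"
      using lin(2) by (simp add: bilinear_def Vector_Spaces.linear_iff sweedler_plus sweedler_scaled)
    show "bilinear sc (\<lambda>a c. sweedler sc (\<lambda>x y. f x y c) a)"
      using f lin(1) by (simp add: multilinear_simps Vector_Spaces.linear_iff sweedler_plus sweedler_scaled)
  qed
  have A: "induced sc (\<lambda>(a, b, c). f a b c) (comult_id scale \<Delta> (\<Delta> 1)) = ?A"
    by (simp add: eval_comult_id f sweedler_one bil)
  have D: "induced sc (\<lambda>(a, b, c). f a b c) (id_comult scale \<Delta> (\<Delta> 1)) = ?D"
    by (simp add: eval_id_comult f sweedler_one bil)
  have B: "induced sc (\<lambda>(a, b, c). f a b c) (comult_id scale \<Delta> (\<Delta> 1))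
     = sweedler sc (\<lambda>a b. sweedler sc (\<lambda>a' b'. f a (b * a') b') 1) 1"
    unfolding comult_one1 tensor_right_def tensor_left_def eval_mult3[OF f]
    by (simp add: eqs free_tensor_left_def free_tensor_right_def case_prod_unfold double_sum_one)
  have C: "induced sc (\<lambda>(a, b, c). f a b c) (comult_id scale \<Delta> (\<Delta> 1))
     = sweedler sc (\<lambda>a b. sweedler sc (\<lambda>a' b'. f a' (a * b') b) 1) 1"
    unfolding comult_one2 tensor_right_def tensor_left_def eval_mult3[OF f]
    by (simp add: eqs free_tensor_left_def free_tensor_right_def case_prod_unfold double_sum_one)
  have "sweedler sc (\<lambda>a b. sweedler sc (\<lambda>a' b'. f a (b * a') b') 1) 1 = ?B"
    using f by (simp add: sweedler_one multilinear_simps sum.distrib W.scale_sum_right)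
  then show "?A = ?B" using A B by simp
  have "sweedler sc (\<lambda>a b. sweedler sc (\<lambda>a' b'. f a' (a * b') b) 1) 1 = ?C"
    using f by (simp add: sweedler_one multilinear_simps sum.distrib W.scale_sum_right
        sum.swap[of "\<lambda>i j. f (one1 i) (one1 j * one2 i) (one2 j)"])
  then show "?A = ?C" using A C by simp
  show "?A = ?D" using A D coassoc[of 1] by simp
qed

end

context weak_hopf_algebra
begin

sublocale H: weak_hopf_algebra_eval scale \<Delta> \<epsilon> S scale ..

sublocale K: weak_hopf_algebra_eval scale \<Delta> \<epsilon> S "(*) :: 'k \<Rightarrow> 'k \<Rightarrow> 'k"
  by unfold_locales (auto simp: algebra_simps)

\<comment> \<open>For the ground field this rule is associativity from right to left, which loops with \<open>mult.assoc\<close>.\<close>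
declare K.W.scale_scale [simp del]

end

context weak_hopf_algebra_eval
begin

lemma bilinear_sum_left:
  assumes "bilinear sc f" shows "f (sum g A) y = (\<Sum>i\<in>A. f (g i) y)"
proof -
  interpret L: Vector_Spaces.linear scale sc "\<lambda>x. f x y"
    using assms by unfold_locales (simp_all add: bilinear_def)
  show ?thesis by (rule L.sum)
qed

lemma bilinear_sum_right:
  assumes "bilinear sc f" shows "f x (sum g A) = (\<Sum>i\<in>A. f x (g i))"
proof -
  interpret L: Vector_Spaces.linear scale sc "f x"
    using assms by unfold_locales (simp_all add: bilinear_def)
  show ?thesis by (rule L.sum)
qed

lemma sweedler_linear_image:
  assumes "Vector_Spaces.linear sc sc' L"
  shows "L (sweedler sc f h) = sweedler sc' (\<lambda>a b. L (f a b)) h"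
proof -
  interpret L: Vector_Spaces.linear sc sc' L by fact
  show ?thesis by (simp add: sweedler_eq linear_extension_def L.sum L.scale case_prod_unfold)
qed

end

context weak_hopf_algebra
begin

abbreviation functional :: "('h \<Rightarrow> 'k) \<Rightarrow> bool" where
  "functional \<phi> \<equiv> Vector_Spaces.linear scale (*) \<phi>"

lemma functional_simps:
  assumes "functional \<phi>"
  shows "\<phi> (x + y) = \<phi> x + \<phi> y" "\<phi> (scale c x) = c * \<phi> x" "\<phi> (sum g A) = (\<Sum>i\<in>A. \<phi> (g i))"
    "\<phi> 0 = 0" "\<phi> (x - y) = \<phi> x - \<phi> y"
proof -
  interpret L: Vector_Spaces.linear scale "(*)" \<phi> by fact
  show "\<phi> (x + y) = \<phi> x + \<phi> y" "\<phi> (scale c x) = c * \<phi> x" "\<phi> (sum g A) = (\<Sum>i\<in>A. \<phi> (g i))"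
    "\<phi> 0 = 0" "\<phi> (x - y) = \<phi> x - \<phi> y"
    by (simp_all add: L.add L.scale L.sum L.diff)
qed

lemma functional_iff: "functional \<phi> \<longleftrightarrow>
    (\<forall>x y. \<phi> (x + y) = \<phi> x + \<phi> y) \<and> (\<forall>c x. \<phi> (scale c x) = c * \<phi> x)"
  using vector_space_axioms K.W.vector_space_axioms by (simp add: Vector_Spaces.linear_iff)

lemma functional_mult_left: "functional \<phi> \<Longrightarrow> functional (\<lambda>x. \<phi> (c * x))"
  by (simp add: functional_iff multilinear_simps)

lemma functionals_separate:
  assumes "\<And>\<phi>. functional \<phi> \<Longrightarrow> \<phi> x = \<phi> y"
  shows "x = y"
proof (rule ccontr)
  assume "x \<noteq> y"
  then obtain \<phi> where "functional \<phi>" "\<phi> (x - y) = 1"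
    using separating_functional[of "{0}" "x - y"] by auto
  then show False using assms[of \<phi>] functional_simps(5)[of \<phi> x y] by simp
qed

lemma counit_left': "sweedler scale (\<lambda>a b. scale (\<epsilon> a) b) h = h"
  and counit_right': "sweedler scale (\<lambda>a b. scale (\<epsilon> b) a) h = h"
  using counit_left[of h] counit_right[of h] by (simp_all add: sweedler_def)

section \<open>The counital subalgebras\<close>

definition source_map :: "'h \<Rightarrow> 'h" where
  "source_map h = sweedler scale (\<lambda>a b. scale (\<epsilon> (h * b)) a) 1"

definition target_map :: "'h \<Rightarrow> 'h" where
  "target_map h = sweedler scale (\<lambda>a b. scale (\<epsilon> (a * h)) b) 1"

text \<open>
  A second projection onto the target counital subalgebra.  It differs from \<open>target_map\<close> by the side on
  which \<open>h\<close> is multiplied, and on the source counital subalgebra it plays the role of the inverse antipode.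
\<close>

definition target_map' :: "'h \<Rightarrow> 'h" where
  "target_map' h = sweedler scale (\<lambda>a b. scale (\<epsilon> (h * a)) b) 1"

definition source_alg :: "'h set" where "source_alg = range source_map"
definition target_alg :: "'h set" where "target_alg = range target_map"

lemma source_alg_eq: "source_alg = source_base scale \<Delta> \<epsilon>"
  by (simp add: source_alg_def source_base_def source_counital_def source_map_def sweedler_def
      fun_eq_iff cong: image_cong)

lemma source_map_raw: "source_map h = (\<Sum>i\<in>one_support. scale (\<epsilon> (h * one2 i)) (one1 i))"
  unfolding source_map_def by (rule H.sweedler_one) (simp add: multilinear_simps)

lemma target_map_raw: "target_map h = (\<Sum>i\<in>one_support. scale (\<epsilon> (one1 i * h)) (one2 i))"
  unfolding target_map_def by (rule H.sweedler_one) (simp add: multilinear_simps)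

lemma source_map_add: "source_map (x + y) = source_map x + source_map y"
  and source_map_scale: "source_map (scale c x) = scale c (source_map x)"
  and target_map_add: "target_map (x + y) = target_map x + target_map y"
  and target_map_scale: "target_map (scale c x) = scale c (target_map x)"
  by (simp_all add: source_map_raw target_map_raw multilinear_simps sum.distrib scale_sum_right)

lemma functional_counit_mult: "functional (\<lambda>x. \<epsilon> (x * h))" "functional (\<lambda>x. \<epsilon> (h * x))"
  by (simp_all add: functional_iff multilinear_simps)

text \<open>
  Applying \<open>id \<otimes> \<epsilon> \<otimes> \<phi>\<close> to the formula \<open>(\<Delta> \<otimes> id) (\<Delta> 1) = (1 \<otimes> \<Delta> 1) (\<Delta> 1 \<otimes> 1)\<close> shows that the slices of \<open>\<Delta> 1\<close> are fixed by
  the counital map.  Hence arbitrary functionals, not only those of the form \<open>\<epsilon> (h * \<dots>)\<close>, produce elements of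
  the source counital subalgebra.
\<close>

lemma source_map_slice:
  assumes \<phi>: "functional \<phi>"
  shows "source_map (\<Sum>i\<in>one_support. scale (\<phi> (one2 i)) (one1 i))
    = (\<Sum>i\<in>one_support. scale (\<phi> (one2 i)) (one1 i))" (is "source_map ?y = ?y")
proof -
  have tri: "trilinear scale (\<lambda>x m z. scale (\<epsilon> m * \<phi> z) x)"
    using \<phi> by (simp add: multilinear_simps functional_iff mult.assoc mult.left_commute)
  have "source_map ?y
      = (\<Sum>i\<in>one_support. \<Sum>j\<in>one_support. scale (\<epsilon> (one1 j * one2 i) * \<phi> (one2 j)) (one1 i))"
    by (simp add: source_map_raw sum_distrib_right counit_sum multilinear_simps scale_sum_left
        mult.commute)
  also have "\<dots> = (\<Sum>i\<in>one_support. sweedler scale (\<lambda>x m. scale (\<epsilon> m * \<phi> (one2 i)) x) (one1 i))"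
    by (rule H.comult_id_one(2)[OF tri, symmetric])
  also have "\<dots> = (\<Sum>i\<in>one_support. scale (\<phi> (one2 i))
      (sweedler scale (\<lambda>x m. scale (\<epsilon> m) x) (one1 i)))"
    by (simp add: H.sweedler_scaled[symmetric] mult.commute)
  finally show ?thesis by (simp add: counit_right')
qed

lemma target_map_slice:
  assumes \<phi>: "functional \<phi>"
  shows "target_map (\<Sum>i\<in>one_support. scale (\<phi> (one1 i)) (one2 i))
    = (\<Sum>i\<in>one_support. scale (\<phi> (one1 i)) (one2 i))" (is "target_map ?z = ?z")
proof -
  have tri: "trilinear scale (\<lambda>x m z. scale (\<phi> x * \<epsilon> m) z)"
    using \<phi> by (simp add: multilinear_simps functional_iff mult.assoc mult.left_commute)
  have "target_map ?z
      = (\<Sum>j\<in>one_support. \<Sum>i\<in>one_support. scale (\<phi> (one1 i) * \<epsilon> (one1 j * one2 i)) (one2 j))"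
    by (simp add: target_map_raw sum_distrib_left counit_sum multilinear_simps scale_sum_left)
  also have "\<dots> = (\<Sum>i\<in>one_support. \<Sum>j\<in>one_support. scale (\<phi> (one1 i) * \<epsilon> (one1 j * one2 i)) (one2 j))"
    by (rule sum.swap)
  also have "\<dots> = (\<Sum>i\<in>one_support. sweedler scale (\<lambda>x m. scale (\<phi> x * \<epsilon> m) (one2 i)) (one1 i))"
    by (rule H.comult_id_one(2)[OF tri, symmetric])
  also have "\<dots> = (\<Sum>i\<in>one_support. sweedler scale (\<lambda>x m. scale (\<phi> (scale (\<epsilon> m) x)) (one2 i)) (one1 i))"
    using \<phi> by (simp add: functional_iff mult.commute)
  also have "\<dots> = (\<Sum>i\<in>one_support. scale (\<phi> (sweedler scale (\<lambda>x m. scale (\<epsilon> m) x) (one1 i))) (one2 i))"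
  proof (rule sum.cong)
    fix i
    have "Vector_Spaces.linear scale scale (\<lambda>x. scale (\<phi> x) (one2 i))"
      using \<phi> by unfold_locales (simp_all add: functional_iff scale_left_distrib)
    from H.sweedler_linear_image[OF this, of "\<lambda>x m. scale (\<epsilon> m) x" "one1 i", symmetric]
    show "sweedler scale (\<lambda>x m. scale (\<phi> (scale (\<epsilon> m) x)) (one2 i)) (one1 i)
      = scale (\<phi> (sweedler scale (\<lambda>x m. scale (\<epsilon> m) x) (one1 i))) (one2 i)" .
  qed simp
  finally show ?thesis by (simp add: counit_right')
qed

lemma source_algE:
  assumes "y \<in> source_alg"
  obtains \<phi> where "functional \<phi>" "y = (\<Sum>i\<in>one_support. scale (\<phi> (one2 i)) (one1 i))"
proof -
  obtain h where "y = source_map h" using assms by (auto simp: source_alg_def)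
  then show thesis
    using functional_counit_mult(2)[of h] by (intro that[of "\<lambda>x. \<epsilon> (h * x)"]) (simp_all add: source_map_raw)
qed

lemma target_algE:
  assumes "z \<in> target_alg"
  obtains \<phi> where "functional \<phi>" "z = (\<Sum>i\<in>one_support. scale (\<phi> (one1 i)) (one2 i))"
proof -
  obtain h where "z = target_map h" using assms by (auto simp: target_alg_def)
  then show thesis
    using functional_counit_mult(1)[of h] by (intro that[of "\<lambda>x. \<epsilon> (x * h)"]) (simp_all add: target_map_raw)
qed

lemma source_map_in [simp]: "source_map h \<in> source_alg"
  by (simp add: source_alg_def)

lemma target_map_in [simp]: "target_map h \<in> target_alg"
  by (simp add: target_alg_def)

lemma source_map_fix: "y \<in> source_alg \<Longrightarrow> source_map y = y"
  by (erule source_algE) (simp add: source_map_slice)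

lemma target_map_fix: "z \<in> target_alg \<Longrightarrow> target_map z = z"
  by (erule target_algE) (simp add: target_map_slice)

text \<open>
  Slicing the two formulas for \<open>(\<Delta> \<otimes> id) (\<Delta> 1)\<close> in the outer legs gives the two products.
\<close>

lemma source_target_commute:
  assumes "y \<in> source_alg" "z \<in> target_alg"
  shows "y * z = z * y"
proof -
  obtain \<phi> where \<phi>: "functional \<phi>" "y = (\<Sum>i\<in>one_support. scale (\<phi> (one2 i)) (one1 i))"
    using assms(1) by (rule source_algE)
  obtain \<psi> where \<psi>: "functional \<psi>" "z = (\<Sum>i\<in>one_support. scale (\<psi> (one1 i)) (one2 i))"
    using assms(2) by (rule target_algE)
  have tri: "trilinear scale (\<lambda>x m w. scale (\<psi> x) (scale (\<phi> w) m))"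
    using \<phi>(1) \<psi>(1) by (simp add: multilinear_simps functional_iff mult.assoc mult.left_commute)
  have "z * y = (\<Sum>i\<in>one_support. \<Sum>j\<in>one_support. scale (\<psi> (one1 i)) (scale (\<phi> (one2 j)) (one2 i * one1 j)))"
    by (simp add: \<phi>(2) \<psi>(2) sum_product scale_mult_left scale_mult_right mult.commute)
  moreover have "y * z = (\<Sum>i\<in>one_support. \<Sum>j\<in>one_support. scale (\<psi> (one1 i)) (scale (\<phi> (one2 j)) (one1 j * one2 i)))"
    by (subst sum.swap) (simp add: \<phi>(2) \<psi>(2) sum_product scale_mult_left scale_mult_right mult.commute)
  ultimately show ?thesis
    using H.comult_id_one(1,2)[OF tri] by simp
qed

text \<open>
  The terms of a representative of \<open>\<Delta> 1\<close> need not lie in the counital subalgebras.  Applying the counital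
  maps to them moves them there without changing the tensor.  The results are the elements \<open>u i\<close> and \<open>v i\<close> of the
  introduction.
\<close>

definition leg1 :: "'h \<times> 'h \<Rightarrow> 'h" where "leg1 i = source_map (one1 i)"
definition leg2 :: "'h \<times> 'h \<Rightarrow> 'h" where "leg2 i = target_map (one2 i)"

lemma leg1_in [simp]: "leg1 i \<in> source_alg" and leg2_in [simp]: "leg2 i \<in> target_alg"
  by (simp_all add: leg1_def leg2_def)

end

context weak_hopf_algebra_eval
begin

text \<open>
  Each of the two replacements is an application of \<open>id \<otimes> \<epsilon> \<otimes> id\<close> to \<open>(1 \<otimes> \<Delta> 1) (\<Delta> 1 \<otimes> 1) = (\<Delta> \<otimes> id) (\<Delta> 1)\<close>: on the left
  the sum over one index is a counital map, and on the right the counit cancels \<open>\<Delta>\<close>.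
\<close>

lemma sweedler_one_legs:
  assumes f: "bilinear sc f"
  shows "sweedler sc f 1 = (\<Sum>i\<in>one_support. f (leg1 i) (leg2 i))"
proof -
  have step: "(\<Sum>i\<in>one_support. \<Sum>j\<in>one_support. sc (\<epsilon> (one1 j * one2 i)) (g (one1 i) (one2 j)))
    = (\<Sum>i\<in>one_support. g (one1 i) (one2 i))" if g: "bilinear sc g" for g
  proof -
    have tri: "trilinear sc (\<lambda>x m w. sc (\<epsilon> m) (g x w))"
      using g by (simp add: multilinear_simps W.scale_right_distrib W.scale_left_distrib mult.commute)
    have eq: "sweedler sc (\<lambda>x m. sc (\<epsilon> m) (g x w)) a = g a w" for a w
    proof -
      have "Vector_Spaces.linear scale sc (\<lambda>x. g x w)"
        using g by unfold_locales (simp_all add: bilinear_def)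
      from H.sweedler_linear_image[OF this, of "\<lambda>x m. scale (\<epsilon> m) x" a]
      show ?thesis using g by (simp add: counit_right' bilinear_def)
    qed
    show ?thesis
      unfolding comult_id_one(2)[OF tri, symmetric] by (simp add: eq)
  qed
  have g: "bilinear sc (\<lambda>x w. f x (target_map w))"
    using f by (simp add: multilinear_simps target_map_add target_map_scale)
  have "(\<Sum>i\<in>one_support. f (leg1 i) (leg2 i))
     = (\<Sum>j\<in>one_support. \<Sum>i\<in>one_support. sc (\<epsilon> (one1 j * one2 i)) (f (one1 i) (leg2 j)))"
    using f unfolding leg1_def source_map_raw
    by (simp add: bilinear_sum_left) (simp add: bilinear_def)
  also have "\<dots> = (\<Sum>i\<in>one_support. \<Sum>j\<in>one_support. sc (\<epsilon> (one1 j * one2 i)) (f (one1 i) (target_map (one2 j))))"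
    unfolding leg2_def by (rule sum.swap)
  also have "\<dots> = (\<Sum>i\<in>one_support. f (one1 i) (target_map (one2 i)))"
    by (rule step[OF g])
  also have "\<dots> = (\<Sum>i\<in>one_support. \<Sum>j\<in>one_support. sc (\<epsilon> (one1 j * one2 i)) (f (one1 i) (one2 j)))"
    using f unfolding target_map_raw
    by (simp add: bilinear_sum_right) (simp add: bilinear_def)
  also have "\<dots> = sweedler sc f 1"
    by (simp add: step[OF f] sweedler_one[OF f])
  finally show ?thesis by simp
qed

lemma sum_legs:
  assumes f: "bilinear sc f"
  shows "(\<Sum>i\<in>one_support. f (one1 i) (one2 i)) = (\<Sum>i\<in>one_support. f (leg1 i) (leg2 i))"
  using sweedler_one_legs[OF f] sweedler_one[OF f] by simp

text \<open>
  This says \<open>\<Delta> y = \<Delta> 1 (1 \<otimes> y) = (1 \<otimes> y) \<Delta> 1\<close>: it is the formula for \<open>(\<Delta> \<otimes> id) (\<Delta> 1)\<close>, sliced in its last leg.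
\<close>

lemma comult_source:
  assumes f: "bilinear sc f" and y: "y \<in> source_alg"
  shows "sweedler sc f y = (\<Sum>i\<in>one_support. f (leg1 i) (leg2 i * y))"
    and "sweedler sc f y = (\<Sum>i\<in>one_support. f (leg1 i) (y * leg2 i))"
proof -
  obtain \<phi> where \<phi>: "functional \<phi>" and y_eq: "y = (\<Sum>i\<in>one_support. scale (\<phi> (one2 i)) (one1 i))"
    using y by (rule source_algE)
  have tri: "trilinear sc (\<lambda>x m w. sc (\<phi> w) (f x m))"
    using \<phi> f by (simp add: multilinear_simps functional_iff W.scale_right_distrib
       W.scale_left_distrib mult.commute)
  interpret L: Vector_Spaces.linear scale sc "sweedler sc f"
    by (rule linear_sweedler[OF f])
  have "sweedler sc f y = (\<Sum>i\<in>one_support. sweedler sc (\<lambda>x m. sc (\<phi> (one2 i)) (f x m)) (one1 i))"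
    by (simp add: y_eq L.sum L.scale sweedler_scaled)
  also have "\<dots> = (\<Sum>i\<in>one_support. \<Sum>j\<in>one_support. sc (\<phi> (one2 j)) (f (one1 i) (one2 i * one1 j)))"
    by (rule comult_id_one(1)[OF tri])
  also have "\<dots> = (\<Sum>i\<in>one_support. f (one1 i) (one2 i * y))"
    using f by (simp add: y_eq sum_distrib_left bilinear_sum_right scale_mult_right)
      (simp add: bilinear_def)
  also have "\<dots> = (\<Sum>i\<in>one_support. f (leg1 i) (leg2 i * y))"
    using f by (intro sum_legs) (simp add: multilinear_simps)
  finally show "sweedler sc f y = (\<Sum>i\<in>one_support. f (leg1 i) (leg2 i * y))" .
  then show "sweedler sc f y = (\<Sum>i\<in>one_support. f (leg1 i) (y * leg2 i))"
    by (simp add: source_target_commute[OF y leg2_in])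
qed

text \<open>
  This says \<open>\<Delta> z = (z \<otimes> 1) \<Delta> 1 = \<Delta> 1 (z \<otimes> 1)\<close>: by coassociativity, \<open>(id \<otimes> \<Delta>) (\<Delta> 1)\<close> can be sliced in its first leg.
\<close>

lemma comult_target:
  assumes f: "bilinear sc f" and z: "z \<in> target_alg"
  shows "sweedler sc f z = (\<Sum>i\<in>one_support. f (z * leg1 i) (leg2 i))"
    and "sweedler sc f z = (\<Sum>i\<in>one_support. f (leg1 i * z) (leg2 i))"
proof -
  obtain \<phi> where \<phi>: "functional \<phi>" and z_eq: "z = (\<Sum>i\<in>one_support. scale (\<phi> (one1 i)) (one2 i))"
    using z by (rule target_algE)
  have tri: "trilinear sc (\<lambda>w x m. sc (\<phi> w) (f x m))"
    using \<phi> f by (simp add: multilinear_simps functional_iff W.scale_right_distrib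
       W.scale_left_distrib mult.commute)
  interpret L: Vector_Spaces.linear scale sc "sweedler sc f"
    by (rule linear_sweedler[OF f])
  have "sweedler sc f z = (\<Sum>i\<in>one_support. sweedler sc (\<lambda>x m. sc (\<phi> (one1 i)) (f x m)) (one2 i))"
    by (simp add: z_eq L.sum L.scale sweedler_scaled)
  also have "\<dots> = (\<Sum>i\<in>one_support. \<Sum>j\<in>one_support. sc (\<phi> (one1 i)) (f (one2 i * one1 j) (one2 j)))"
    using comult_id_one(1,3)[OF tri] by simp
  also have "\<dots> = (\<Sum>j\<in>one_support. \<Sum>i\<in>one_support. sc (\<phi> (one1 i)) (f (one2 i * one1 j) (one2 j)))"
    by (rule sum.swap)
  also have "\<dots> = (\<Sum>j\<in>one_support. f (z * one1 j) (one2 j))"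
    using f by (simp add: z_eq sum_distrib_right bilinear_sum_left scale_mult_left)
      (simp add: bilinear_def)
  also have "\<dots> = (\<Sum>i\<in>one_support. f (z * leg1 i) (leg2 i))"
    using f by (intro sum_legs) (simp add: multilinear_simps)
  finally show "sweedler sc f z = (\<Sum>i\<in>one_support. f (z * leg1 i) (leg2 i))" .
  then show "sweedler sc f z = (\<Sum>i\<in>one_support. f (leg1 i * z) (leg2 i))"
    by (simp add: source_target_commute[OF leg1_in z])
qed

lemma comult_one_idem:
  assumes f: "bilinear sc f"
  shows "(\<Sum>i\<in>one_support. \<Sum>j\<in>one_support. f (leg1 i * leg1 j) (leg2 i * leg2 j))
    = (\<Sum>i\<in>one_support. f (leg1 i) (leg2 i))"
proof -
  have "sweedler sc f (1 * 1) = sweedler sc (\<lambda>a b. \<Sum>j\<in>one_support. f (a * leg1 j) (b * leg2 j)) 1"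
    using f unfolding sweedler_mult[OF f]
    by (subst sweedler_one_legs) (simp_all add: multilinear_simps)
  also have "\<dots> = (\<Sum>i\<in>one_support. \<Sum>j\<in>one_support. f (leg1 i * leg1 j) (leg2 i * leg2 j))"
    using f by (intro sweedler_one_legs)
      (simp add: multilinear_simps sum.distrib W.scale_sum_right)
  finally show ?thesis by (simp add: sweedler_one_legs[OF f])
qed

lemma comult_source_mult_target:
  assumes f: "bilinear sc f" and y: "y \<in> source_alg" and z: "z \<in> target_alg"
  shows "sweedler sc f (y * z) = (\<Sum>i\<in>one_support. f (leg1 i * z) (y * leg2 i))"
proof -
  have f1: "bilinear sc (\<lambda>a' b'. f (a * a') (b * b'))" for a b
    using f by (simp add: multilinear_simps)
  have "sweedler sc f (y * z) = sweedler sc (\<lambda>a b. \<Sum>j\<in>one_support. f (a * (leg1 j * z)) (b * leg2 j)) y"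
    by (simp add: sweedler_mult[OF f] comult_target(2)[OF f1 z])
  also have "\<dots> = (\<Sum>i\<in>one_support. \<Sum>j\<in>one_support. f (leg1 i * (leg1 j * z)) (y * leg2 i * leg2 j))"
    using f by (intro comult_source(2)[OF _ y]) (simp add: multilinear_simps sum.distrib W.scale_sum_right)
  also have "\<dots> = (\<Sum>i\<in>one_support. f (leg1 i * z) (y * leg2 i))"
    using f comult_one_idem[of "\<lambda>a b. f (a * z) (y * b)"] by (simp add: multilinear_simps mult.assoc)
  finally show ?thesis .
qed

end

context weak_hopf_algebra
begin

lemma source_map_legs: "source_map h = (\<Sum>i\<in>one_support. scale (\<epsilon> (h * leg2 i)) (leg1 i))"
  unfolding source_map_def by (rule H.sweedler_one_legs) (simp add: multilinear_simps)

lemma target_map_legs: "target_map h = (\<Sum>i\<in>one_support. scale (\<epsilon> (leg1 i * h)) (leg2 i))"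
  unfolding target_map_def by (rule H.sweedler_one_legs) (simp add: multilinear_simps)

lemma target_map'_legs: "target_map' h = (\<Sum>i\<in>one_support. scale (\<epsilon> (h * leg1 i)) (leg2 i))"
  unfolding target_map'_def by (rule H.sweedler_one_legs) (simp add: multilinear_simps)

lemma subspace_source: "subspace source_alg"
proof (rule subspaceI)
  show "0 \<in> source_alg" using source_map_scale[of 0 0] source_map_in[of 0] by simp
  show "x + y \<in> source_alg" if "x \<in> source_alg" "y \<in> source_alg" for x y
    using that source_map_fix source_map_add source_map_in by metis
  show "scale c x \<in> source_alg" if "x \<in> source_alg" for c x
    using that source_map_fix source_map_scale source_map_in by metis
qed

lemma subspace_target: "subspace target_alg"
proof (rule subspaceI)
  show "0 \<in> target_alg" using target_map_scale[of 0 0] target_map_in[of 0] by simp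
  show "x + y \<in> target_alg" if "x \<in> target_alg" "y \<in> target_alg" for x y
    using that target_map_fix target_map_add target_map_in by metis
  show "scale c x \<in> target_alg" if "x \<in> target_alg" for c x
    using that target_map_fix target_map_scale target_map_in by metis
qed

lemma source_map_one [simp]: "source_map 1 = 1" and target_map_one [simp]: "target_map 1 = 1"
  unfolding source_map_def target_map_def by (simp_all add: counit_left' counit_right')

lemma one_source [simp]: "1 \<in> source_alg" and one_target [simp]: "1 \<in> target_alg"
  using source_map_in[of 1] target_map_in[of 1] by simp_all

lemma source_mult [simp]:
  assumes x: "x \<in> source_alg" and y: "y \<in> source_alg"
  shows "x * y \<in> source_alg"
proof -
  have f: "bilinear scale (\<lambda>a b. scale (\<epsilon> b) a)" "\<And>c d. bilinear scale (\<lambda>a b. scale (\<epsilon> (d * b)) (c * a))"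
    by (simp_all add: multilinear_simps)
  have g: "bilinear scale (\<lambda>a b. \<Sum>j\<in>one_support. scale (\<epsilon> (b * (leg2 j * y))) (a * leg1 j))"
    by (simp add: multilinear_simps sum.distrib scale_sum_right mult.commute)
  have "x * y = sweedler scale (\<lambda>a b. scale (\<epsilon> b) a) (x * y)"
    by (simp add: counit_right')
  also have "\<dots> = (\<Sum>i\<in>one_support. \<Sum>j\<in>one_support.
      scale (\<epsilon> (x * leg2 i * (leg2 j * y))) (leg1 i * leg1 j))"
    by (simp add: H.sweedler_mult[OF f(1)] H.comult_source(1)[OF f(2) y] H.comult_source(2)[OF g x])
  also have "\<dots> \<in> source_alg"
  proof -
    have h: "bilinear scale (\<lambda>a b. scale (\<epsilon> (x * b * y)) a)"
      by (simp add: multilinear_simps)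
    show ?thesis
      using H.comult_one_idem[OF h] subspace_source
      by (simp add: mult.assoc) (intro subspace_sum subspace_scale subspace_source leg1_in)
  qed
  finally show ?thesis .
qed

lemma target_mult [simp]:
  assumes x: "x \<in> target_alg" and y: "y \<in> target_alg"
  shows "x * y \<in> target_alg"
proof -
  have f: "bilinear scale (\<lambda>a b. scale (\<epsilon> a) b)" "\<And>c d. bilinear scale (\<lambda>a b. scale (\<epsilon> (c * a)) (d * b))"
    by (simp_all add: multilinear_simps)
  have g: "bilinear scale (\<lambda>a b. \<Sum>j\<in>one_support. scale (\<epsilon> (a * (leg1 j * y))) (b * leg2 j))"
    by (simp add: multilinear_simps sum.distrib scale_sum_right mult.commute)
  have "x * y = sweedler scale (\<lambda>a b. scale (\<epsilon> a) b) (x * y)"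
    by (simp add: counit_left')
  also have "\<dots> = (\<Sum>i\<in>one_support. \<Sum>j\<in>one_support.
      scale (\<epsilon> (x * leg1 i * (leg1 j * y))) (leg2 i * leg2 j))"
    by (simp add: H.sweedler_mult[OF f(1)] H.comult_target(2)[OF f(2) y] H.comult_target(1)[OF g x])
  also have "\<dots> \<in> target_alg"
  proof -
    have h: "bilinear scale (\<lambda>a b. scale (\<epsilon> (x * a * y)) b)"
      by (simp add: multilinear_simps)
    show ?thesis
      using H.comult_one_idem[OF h]
      by (simp add: mult.assoc) (intro subspace_sum subspace_scale subspace_target leg2_in)
  qed
  finally show ?thesis .
qed

lemma target_map'_in [simp]: "target_map' h \<in> target_alg"
  unfolding target_map'_legs by (intro subspace_sum subspace_scale subspace_target leg2_in)

lemma counit_mult_one: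
  "\<epsilon> (f * h) = (\<Sum>i\<in>one_support. \<epsilon> (f * leg1 i) * \<epsilon> (leg2 i * h))"
  "\<epsilon> (f * h) = (\<Sum>i\<in>one_support. \<epsilon> (f * leg2 i) * \<epsilon> (leg1 i * h))"
proof -
  have bil: "bilinear (*) (\<lambda>a b. \<epsilon> (f * a) * \<epsilon> (b * h))" "bilinear (*) (\<lambda>a b. \<epsilon> (f * b) * \<epsilon> (a * h))"
    by (simp_all add: multilinear_simps)
  show "\<epsilon> (f * h) = (\<Sum>i\<in>one_support. \<epsilon> (f * leg1 i) * \<epsilon> (leg2 i * h))"
    using counit_mult1[of f 1 h] K.sweedler_one_legs[OF bil(1)] by (simp add: sweedler_def)
  show "\<epsilon> (f * h) = (\<Sum>i\<in>one_support. \<epsilon> (f * leg2 i) * \<epsilon> (leg1 i * h))"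
    using counit_mult2[of f 1 h] K.sweedler_one_legs[OF bil(2)] by (simp add: sweedler_def)
qed

text \<open>
  Weak multiplicativity of the counit, applied to the product \<open>f * 1 * h\<close>.
\<close>

lemma counit_mult_target_map: "\<epsilon> (f * target_map h) = \<epsilon> (f * h)"
  by (subst counit_mult_one(2))
    (simp add: target_map_legs sum_distrib_left counit_sum multilinear_simps mult.commute)

lemma counit_source_map_mult: "\<epsilon> (source_map f * h) = \<epsilon> (f * h)"
  by (subst (2) counit_mult_one(2))
    (simp add: source_map_legs sum_distrib_right counit_sum multilinear_simps)

lemma counit_target_map'_mult: "\<epsilon> (target_map' f * h) = \<epsilon> (f * h)"
  by (subst (2) counit_mult_one(1))
    (simp add: target_map'_legs sum_distrib_right counit_sum multilinear_simps)

lemma counit_diff: "\<epsilon> (x - y) = \<epsilon> x - \<epsilon> y"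
  using functional_simps(5)[OF counit_linear] .

lemma counit_zero [simp]: "\<epsilon> 0 = 0"
  using functional_simps(4)[OF counit_linear] .

text \<open>
  The pairing \<open>(y, z) \<mapsto> \<epsilon> (y * z)\<close> between the counital subalgebras is nondegenerate, since \<open>\<Delta> 1\<close> provides dual bases.
\<close>

lemma source_eqI:
  assumes "y \<in> source_alg" "y' \<in> source_alg" "\<And>z. z \<in> target_alg \<Longrightarrow> \<epsilon> (y * z) = \<epsilon> (y' * z)"
  shows "y = y'"
proof -
  have "source_map y = source_map y'" using assms by (simp add: source_map_legs)
  then show ?thesis using assms by (simp add: source_map_fix)
qed

lemma target_eqI:
  assumes "z \<in> target_alg" "z' \<in> target_alg" "\<And>y. y \<in> source_alg \<Longrightarrow> \<epsilon> (y * z) = \<epsilon> (y * z')"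
  shows "z = z'"
proof -
  have "target_map z = target_map z'" using assms by (simp add: target_map_legs)
  then show ?thesis using assms by (simp add: target_map_fix)
qed

lemma target_map_mult_target:
  assumes z: "z \<in> target_alg" shows "target_map (z * h) = z * target_map h"
proof (rule target_eqI)
  fix y
  show "\<epsilon> (y * target_map (z * h)) = \<epsilon> (y * (z * target_map h))"
    using counit_mult_target_map[of "y * z" h] by (simp add: counit_mult_target_map mult.assoc)
qed (use z in simp_all)

lemma target_map_mult_source:
  assumes y: "y \<in> source_alg" and y': "y' \<in> source_alg"
  shows "target_map (y * y') = target_map y' * target_map y"
proof (rule target_eqI)
  fix x assume x: "x \<in> source_alg"
  have "\<epsilon> (x * (target_map y' * target_map y)) = \<epsilon> (x * (target_map y' * y))"
    using counit_mult_target_map[of "x * target_map y'" y] by (simp add: mult.assoc)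
  also have "\<dots> = \<epsilon> (x * y * target_map y')"
    by (simp add: source_target_commute[OF y target_map_in] mult.assoc)
  also have "\<dots> = \<epsilon> (x * target_map (y * y'))"
    using counit_mult_target_map[of "x * y" y'] by (simp add: counit_mult_target_map mult.assoc)
  finally show "\<epsilon> (x * target_map (y * y')) = \<epsilon> (x * (target_map y' * target_map y))" by simp
qed simp_all

end

context weak_hopf_algebra_eval
begin

text \<open>
  This says \<open>(y \<otimes> 1) \<Delta> 1 = (1 \<otimes> target_map' y) \<Delta> 1\<close>: the pairing transports left multiplication by \<open>y\<close> to the other leg.
\<close>

lemma sum_legs_move_left:
  assumes f: "bilinear sc f" and y: "y \<in> source_alg"
  shows "(\<Sum>i\<in>one_support. f (y * leg1 i) (leg2 i)) = (\<Sum>i\<in>one_support. f (leg1 i) (target_map' y * leg2 i))"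
proof -
  have eq: "target_map' y * leg2 j = target_map' (y * leg2 j)" for j
  proof (rule target_eqI)
    fix x assume x: "x \<in> source_alg"
    have "\<epsilon> (x * (target_map' y * leg2 j)) = \<epsilon> (target_map' y * (leg2 j * x))"
      by (simp add: source_target_commute[OF x] mult.assoc)
    also have "\<dots> = \<epsilon> (y * leg2 j * x)" by (simp add: counit_target_map'_mult mult.assoc)
    also have "\<dots> = \<epsilon> (x * target_map' (y * leg2 j))"
      by (simp add: source_target_commute[OF x] counit_target_map'_mult)
    finally show "\<epsilon> (x * (target_map' y * leg2 j)) = \<epsilon> (x * target_map' (y * leg2 j))" .
  qed simp_all
  have "(\<Sum>i\<in>one_support. f (y * leg1 i) (leg2 i)) = (\<Sum>i\<in>one_support. f (source_map (y * leg1 i)) (leg2 i))"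
    using y by (simp add: source_map_fix)
  also have "\<dots> = (\<Sum>i\<in>one_support. \<Sum>j\<in>one_support. sc (\<epsilon> (y * leg1 i * leg2 j)) (f (leg1 j) (leg2 i)))"
    using f by (simp add: source_map_legs bilinear_sum_left) (simp add: bilinear_def)
  also have "\<dots> = (\<Sum>j\<in>one_support. \<Sum>i\<in>one_support. sc (\<epsilon> (y * leg1 i * leg2 j)) (f (leg1 j) (leg2 i)))"
    by (rule sum.swap)
  also have "\<dots> = (\<Sum>j\<in>one_support. f (leg1 j) (target_map' (y * leg2 j)))"
    using f by (simp add: target_map'_legs bilinear_sum_right source_target_commute[OF leg1_in leg2_in] mult.assoc)
      (simp add: bilinear_def)
  finally show ?thesis by (simp add: eq)
qed

end

context weak_hopf_algebra
begin

section \<open>The antipode on products of counital elements\<close>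

lemma antipode_conv_target: "sweedler scale (\<lambda>a b. a * S b) h = target_map h"
proof -
  have f: "bilinear scale (\<lambda>a b. scale (\<epsilon> a) b)" by (simp add: multilinear_simps)
  show ?thesis
    using antipode_right[of h] H.eval_comult_mult_pure[OF f] by (simp add: sweedler_def target_map_def)
qed

lemma antipode_conv_source: "sweedler scale (\<lambda>a b. S a * b) h = source_map h"
proof -
  have f: "bilinear scale (\<lambda>a b. scale (\<epsilon> b) a)" by (simp add: multilinear_simps)
  show ?thesis
    using antipode_left[of h] H.eval_pure_mult_comult[OF f] by (simp add: sweedler_def source_map_def)
qed

text \<open>
  Coassociativity allows the last two factors of \<open>S h = S h\<^sub>(\<^sub>1\<^sub>) h\<^sub>(\<^sub>2\<^sub>) S h\<^sub>(\<^sub>3\<^sub>)\<close> to be combined.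
\<close>

lemma antipode_eq: "S h = sweedler scale (\<lambda>a b. S a * target_map b) h"
proof -
  have f: "trilinear scale (\<lambda>a b c. S a * b * S c)" by (simp add: multilinear_simps)
  have "S h = sweedler scale (\<lambda>a c. sweedler scale (\<lambda>x y. S a * x * S y) c) h"
    using antipode[of h] H.eval_id_comult[OF f] by (simp add: coassoc)
  also have "(\<lambda>a c. sweedler scale (\<lambda>x y. S a * x * S y) c) = (\<lambda>a c. S a * target_map c)"
    by (simp add: H.sweedler_linear_image[OF linear_mult_left, symmetric]
        antipode_conv_target[symmetric] mult.assoc)
  finally show ?thesis .
qed

text \<open>
  Insert \<open>\<Delta> (y * z) = \<Sum>i. u i * z \<otimes> y * v i\<close> into the preceding formula for \<open>S\<close> and pull \<open>v i\<close> out of the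
  target counital map.  The formula is used to show that certain idempotents lie in both counital subalgebras.
\<close>

lemma antipode_source_mult_target:
  assumes y: "y \<in> source_alg" and z: "z \<in> target_alg"
  shows "S (y * z) = source_map z * target_map y"
proof -
  have f: "bilinear scale (\<lambda>a b. S a * target_map b)" "bilinear scale (\<lambda>a b. S a * b)"
    by (simp_all add: multilinear_simps target_map_add target_map_scale)
  have "S (y * z) = (\<Sum>i\<in>one_support. S (leg1 i * z) * target_map (y * leg2 i))"
    unfolding antipode_eq[of "y * z"] by (rule H.comult_source_mult_target[OF f(1) y z])
  also have "\<dots> = (\<Sum>i\<in>one_support. S (leg1 i * z) * leg2 i) * target_map y"
    by (simp add: source_target_commute[OF y leg2_in] target_map_mult_target sum_distrib_right mult.assoc)
  also have "(\<Sum>i\<in>one_support. S (leg1 i * z) * leg2 i) = source_map z"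
    using H.comult_target(2)[OF f(2) z] by (simp add: antipode_conv_source)
  finally show ?thesis .
qed

lemma antipode_source: "y \<in> source_alg \<Longrightarrow> S y = target_map y"
  using antipode_source_mult_target[of y 1] by simp

section \<open>Separability of the source counital subalgebra\<close>

lemma separability_unit: "(\<Sum>i\<in>one_support. leg1 i * source_map (leg2 i)) = 1"
proof -
  have f: "bilinear scale (\<lambda>a b. scale (\<epsilon> b) a)" by (simp add: multilinear_simps)
  have "(\<Sum>i\<in>one_support. leg1 i * source_map (leg2 i))
    = (\<Sum>i\<in>one_support. \<Sum>j\<in>one_support. scale (\<epsilon> (leg2 i * leg2 j)) (leg1 i * leg1 j))"
    by (simp add: source_map_legs sum_distrib_left scale_mult_right)
  then show ?thesis
    using H.comult_one_idem[OF f] H.sweedler_one_legs[OF f] by (simp add: counit_right')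
qed

text \<open>
  Together with the preceding lemma, this says that \<open>\<Sum>i. u i \<otimes> source_map (v i)\<close> is a separability idempotent
  of the source counital subalgebra.
\<close>

lemma separability_move:
  assumes f: "bilinear scale f" and y: "y \<in> source_alg"
  shows "(\<Sum>i\<in>one_support. f (y * leg1 i) (source_map (leg2 i)))
    = (\<Sum>i\<in>one_support. f (leg1 i) (source_map (leg2 i) * y))"
proof -
  have eq: "source_map (target_map' y * leg2 i) = source_map (leg2 i) * y" for i
  proof (rule source_eqI)
    fix z assume z: "z \<in> target_alg"
    have "\<epsilon> (source_map (leg2 i) * y * z) = \<epsilon> (leg2 i * (y * z))"
      by (simp add: counit_source_map_mult mult.assoc)
    also have "leg2 i * (y * z) = y * (leg2 i * z)"
      by (simp add: source_target_commute[OF y leg2_in] mult.assoc[symmetric])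
    also have "\<epsilon> (y * (leg2 i * z)) = \<epsilon> (source_map (target_map' y * leg2 i) * z)"
      by (simp add: counit_source_map_mult counit_target_map'_mult mult.assoc)
    finally show "\<epsilon> (source_map (target_map' y * leg2 i) * z) = \<epsilon> (source_map (leg2 i) * y * z)" by simp
  qed (use y in simp_all)
  have "bilinear scale (\<lambda>a b. f a (source_map b))"
    using f by (simp add: bilinear_def source_map_add source_map_scale)
  from H.sum_legs_move_left[OF this y] show ?thesis by (simp add: eq)
qed

text \<open>
  Averaging a linear projection onto \<open>J\<close> over the separability idempotent gives a projection that is linear over
  the algebra from the left, or from the right.  The images of \<open>1\<close> are a right and a left unit of \<open>J\<close>; these
  coincide, and a two-sided unit of an ideal is central.
\<close>

lemma ideal_has_central_unit:
  assumes J: "subspace J" "J \<subseteq> source_alg"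
    and left: "\<And>x y. x \<in> J \<Longrightarrow> y \<in> source_alg \<Longrightarrow> y * x \<in> J"
    and right: "\<And>x y. x \<in> J \<Longrightarrow> y \<in> source_alg \<Longrightarrow> x * y \<in> J"
  obtains j where "j \<in> J" "\<And>x. x \<in> J \<Longrightarrow> x * j = x" "\<And>y. y \<in> source_alg \<Longrightarrow> y * j = j * y"
proof -
  interpret P: vector_space_pair scale scale ..
  obtain B where B: "B \<subseteq> J" "independent B" "J \<subseteq> span B"
    using basis_exists[of J] by metis
  have sp: "span B = J" using B J(1) by (metis span_minimal subset_antisym)
  obtain \<pi> where \<pi>: "Vector_Spaces.linear scale scale \<pi>" "\<forall>x\<in>B. \<pi> x = x" "range \<pi> = span B"
    using P.linear_independent_extend_subspace[OF B(2), of id] by auto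
  interpret \<pi>: Vector_Spaces.linear scale scale \<pi> by (rule \<pi>(1))
  have \<pi>_in: "\<pi> x \<in> J" for x using \<pi>(3) sp by auto
  have \<pi>_fix: "\<pi> x = x" if "x \<in> J" for x
    by (rule P.linear_eq_on[OF \<pi>(1) linear_ident, of x B]) (use that sp \<pi>(2) in simp_all)
  have bl: "bilinear scale (\<lambda>a b. a * \<pi> (b * x))" "bilinear scale (\<lambda>a b. \<pi> (x * a) * b)" for x
    by (simp_all add: multilinear_simps \<pi>.add \<pi>.scale)
  let ?s = "\<lambda>i. source_map (leg2 i)"
  define j where "j = (\<Sum>i\<in>one_support. leg1 i * \<pi> (?s i))"
  define j' where "j' = (\<Sum>i\<in>one_support. \<pi> (leg1 i) * ?s i)"
  have jJ: "j \<in> J" and jJ': "j' \<in> J"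
    unfolding j_def j'_def by (intro subspace_sum J left right \<pi>_in leg1_in source_map_in)+
  have xj: "x * j = x" if "x \<in> J" for x
  proof -
    have x: "x \<in> source_alg" using that J by blast
    have "x * j = (\<Sum>i\<in>one_support. leg1 i * \<pi> (?s i * x))"
      using separability_move[OF bl(1)[of 1] x] by (simp add: j_def sum_distrib_left mult.assoc)
    also have "\<dots> = (\<Sum>i\<in>one_support. leg1 i * ?s i) * x"
      by (simp add: \<pi>_fix left that sum_distrib_right mult.assoc)
    finally show ?thesis by (simp add: separability_unit)
  qed
  have jx: "j' * x = x" if "x \<in> J" for x
  proof -
    have x: "x \<in> source_alg" using that J by blast
    have "j' * x = (\<Sum>i\<in>one_support. \<pi> (x * leg1 i) * ?s i)"
      using separability_move[OF bl(2)[of 1] x] by (simp add: j'_def sum_distrib_right mult.assoc)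
    also have "\<dots> = x * (\<Sum>i\<in>one_support. leg1 i * ?s i)"
      by (simp add: \<pi>_fix right that sum_distrib_left mult.assoc)
    finally show ?thesis by (simp add: separability_unit)
  qed
  have "j = j'" using xj[OF jJ'] jx[OF jJ] by simp
  then have "y * j = j * y" if "y \<in> source_alg" for y
    using xj[OF right[OF jJ that]] jx[OF left[OF jJ that]] by (metis mult.assoc)
  then show thesis using that jJ xj by blast
qed

section \<open>Idempotents common to both counital subalgebras\<close>

definition base_idempotent :: "'h \<Rightarrow> bool" where
  "base_idempotent e \<longleftrightarrow> e \<in> source_alg \<and> e \<in> target_alg \<and> e * e = e"

text \<open>
  Zero counts as primitive, so that every other idempotent is a sum of two smaller nonzero ones.
\<close>

definition primitive_base_idempotent :: "'h \<Rightarrow> bool" where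
  "primitive_base_idempotent e \<longleftrightarrow> base_idempotent e
    \<and> (\<forall>c. base_idempotent c \<and> e * c = c \<longrightarrow> c = 0 \<or> c = e)"

lemma base_idempotent_commute:
  assumes "base_idempotent e"
  shows "y \<in> source_alg \<Longrightarrow> y * e = e * y" "z \<in> target_alg \<Longrightarrow> z * e = e * z"
  using assms source_target_commute[of y e] source_target_commute[of e z]
  by (simp_all add: base_idempotent_def)

lemma sum_legs_base_idempotent:
  assumes f: "bilinear scale f" and e: "base_idempotent e"
  shows "(\<Sum>i\<in>one_support. f (e * leg1 i) (leg2 i)) = (\<Sum>i\<in>one_support. f (leg1 i) (e * leg2 i))"
  using H.comult_target(1)[OF f, of e] H.comult_source(2)[OF f, of e] e
  by (simp add: base_idempotent_def)

text \<open>
  The elements \<open>\<Sum>i. \<phi> (z * u i) v i\<close> form the subcoideal generated by \<open>z\<close>.  Under the pairing \<open>\<epsilon> (x * z')\<close> its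
  orthogonal complement in \<open>e H\<^sub>s\<close> is the annihilator of \<open>z\<close>, so an element orthogonal to this
  annihilator belongs to the subcoideal.
\<close>

lemma slice_orthogonal:
  assumes e: "base_idempotent e" and z: "z \<in> target_alg" "e * z = z"
    and z': "z' \<in> target_alg" "e * z' = z'"
    and orth: "\<And>x. x \<in> source_alg \<Longrightarrow> e * x = x \<Longrightarrow> x * z = 0 \<Longrightarrow> \<epsilon> (x * z') = 0"
  obtains \<phi> where "functional \<phi>" "z' = (\<Sum>i\<in>one_support. scale (\<phi> (z * leg1 i)) (leg2 i))"
proof -
  let ?w = "\<lambda>\<phi>. \<Sum>i\<in>one_support. scale (\<phi> (z * leg1 i)) (leg2 i)"
  define W where "W = {?w \<phi> | \<phi>. functional \<phi>}"
  have "subspace W"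
  proof (rule subspaceI)
    show "0 \<in> W" unfolding W_def
      by (intro CollectI exI[of _ "\<lambda>x. 0"]) (simp add: functional_iff)
  next
    fix x y assume "x \<in> W" "y \<in> W"
    then obtain \<phi> \<psi> where *: "functional \<phi>" "x = ?w \<phi>" "functional \<psi>" "y = ?w \<psi>"
      by (auto simp: W_def)
    have "functional (\<lambda>x. \<phi> x + \<psi> x)" using * by (simp add: functional_iff algebra_simps)
    moreover have "x + y = ?w (\<lambda>x. \<phi> x + \<psi> x)" by (simp add: * scale_left_distrib sum.distrib)
    ultimately show "x + y \<in> W"
      unfolding W_def by (intro CollectI exI[of _ "\<lambda>x. \<phi> x + \<psi> x"] conjI)
  next
    fix c x assume "x \<in> W"
    then obtain \<phi> where *: "functional \<phi>" "x = ?w \<phi>" by (auto simp: W_def)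
    have "functional (\<lambda>x. c * \<phi> x)" using * by (simp add: functional_iff algebra_simps)
    moreover have "scale c x = ?w (\<lambda>x. c * \<phi> x)" by (simp add: * scale_sum_right)
    ultimately show "scale c x \<in> W"
      unfolding W_def by (intro CollectI exI[of _ "\<lambda>x. c * \<phi> x"] conjI)
  qed
  have "z' \<in> W"
  proof (rule ccontr)
    assume "z' \<notin> W"
    then obtain \<psi> where \<psi>: "functional \<psi>" "\<forall>x\<in>W. \<psi> x = 0" "\<psi> z' = 1"
      using separating_functional[OF \<open>subspace W\<close>] by blast
    note \<psi>s = functional_simps[OF \<psi>(1)]
    \<comment> \<open>By duality, \<open>x\<close> represents \<open>\<psi>\<close> on \<open>e H\<^sub>t\<close>: there \<open>\<psi> z' = \<epsilon> (x * z')\<close>.\<close>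
    define x where "x = e * (\<Sum>i\<in>one_support. scale (\<psi> (leg2 i)) (leg1 i))"
    have e': "e \<in> source_alg" "e * e = e" using e by (simp_all add: base_idempotent_def)
    have x: "x \<in> source_alg"
      unfolding x_def by (intro source_mult e' subspace_sum subspace_scale subspace_source leg1_in)
    have ex: "e * x = x" by (simp add: x_def mult.assoc[symmetric] e')
    have "z * x = 0"
    proof (rule functionals_separate)
      fix \<phi> assume \<phi>: "functional \<phi>"
      have "z * x = (\<Sum>i\<in>one_support. scale (\<psi> (leg2 i)) (z * leg1 i))"
        by (simp add: x_def sum_distrib_left scale_mult_right mult.assoc[symmetric]
            base_idempotent_commute(2)[OF e z(1)] z(2))
      then have "\<phi> (z * x) = (\<Sum>i\<in>one_support. \<psi> (leg2 i) * \<phi> (z * leg1 i))"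
        by (simp add: functional_simps[OF \<phi>])
      also have "\<dots> = \<psi> (?w \<phi>)" by (simp add: \<psi>s mult.commute)
      also have "\<dots> = 0" using \<phi> \<psi>(2) by (auto simp: W_def)
      finally show "\<phi> (z * x) = \<phi> 0" by (simp add: functional_simps[OF \<phi>])
    qed
    then have "\<epsilon> (x * z') = 0" using orth x ex source_target_commute[OF x z(1)] by simp
    moreover have "x * z' = (\<Sum>i\<in>one_support. scale (\<psi> (leg2 i)) (leg1 i * z'))"
    proof -
      have "e * leg1 i * z' = leg1 i * z'" for i
        by (simp add: base_idempotent_commute(1)[OF e leg1_in, symmetric] mult.assoc z'(2))
      then show ?thesis
        by (simp add: x_def sum_distrib_left sum_distrib_right scale_mult_right scale_mult_left)
    qed
    moreover have "\<psi> (target_map z') = (\<Sum>i\<in>one_support. \<epsilon> (leg1 i * z') * \<psi> (leg2 i))"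
      by (simp add: target_map_legs \<psi>s)
    ultimately show False
      using \<psi>(3) z'(1) by (simp add: target_map_fix counit_sum counit_scale mult.commute)
  qed
  then show thesis using that by (auto simp: W_def)
qed

text \<open>
  On the source counital subalgebra, \<open>target_map\<close> is the antipode and \<open>target_map'\<close> its inverse; the two agree at a
  central element \<open>j\<close>, because \<open>S j\<close> commutes with \<open>H\<^sub>t\<close> and both compute the same pairing under \<open>\<epsilon>\<close>.  So the square
  of the antipode fixes the centre.
\<close>

lemma source_map_target_map_central:
  assumes j: "j \<in> source_alg" and central: "\<And>y. y \<in> source_alg \<Longrightarrow> y * j = j * y"
  shows "source_map (target_map j) = j"
proof -
  have eq: "target_map' j = target_map j"
  proof (rule target_eqI)
    fix x assume x: "x \<in> source_alg"
    have "\<epsilon> (x * target_map' j) = \<epsilon> (target_map' j * target_map x)"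
      by (simp add: source_target_commute[OF x] counit_mult_target_map)
    also have "\<dots> = \<epsilon> (target_map x * target_map j)"
      by (subst counit_target_map'_mult, subst source_target_commute[OF j target_map_in],
          subst counit_mult_target_map) (rule refl)
    also have "\<dots> = \<epsilon> (target_map j * target_map x)"
      using central[OF x] x j by (simp add: target_map_mult_source[symmetric])
    also have "\<dots> = \<epsilon> (x * target_map j)"
      by (simp add: source_target_commute[OF x] counit_mult_target_map)
    finally show "\<epsilon> (x * target_map' j) = \<epsilon> (x * target_map j)" .
  qed simp_all
  show ?thesis
  proof (rule source_eqI)
    fix z
    show "\<epsilon> (source_map (target_map j) * z) = \<epsilon> (j * z)"
      using counit_target_map'_mult[of j z] by (simp add: counit_source_map_mult eq)
  qed (use j in simp_all)
qed

text \<open>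
  The annihilator of \<open>z\<close> in \<open>e H\<^sub>s\<close> is a two-sided ideal because \<open>z\<close> commutes with \<open>H\<^sub>s\<close>, so it has a central unit \<open>j\<close>.
  Put \<open>w = S j\<close>.  The element \<open>e - w\<close> is orthogonal to the annihilator, hence lies in the coideal generated
  by \<open>z\<close>, which \<open>j\<close> annihilates together with \<open>z\<close>.  This gives \<open>j * w = j\<close>, and applying \<open>S\<close> turns it into
  \<open>j * w = w\<close>.  Thus \<open>j = w\<close> lies in both counital subalgebras, and primitivity leaves only \<open>j = e\<close>, which does
  not annihilate \<open>z\<close>.
\<close>

lemma primitive_no_zero_divisors:
  assumes e: "primitive_base_idempotent e" and y: "y \<in> source_alg" "e * y = y"
    and z: "z \<in> target_alg" "e * z = z" and yz: "y * z = 0"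
  shows "y = 0 \<or> z = 0"
proof (rule ccontr)
  assume "\<not> (y = 0 \<or> z = 0)"
  then have nz: "y \<noteq> 0" "z \<noteq> 0" by auto
  have be: "base_idempotent e" using e by (simp add: primitive_base_idempotent_def)
  have e': "e \<in> source_alg" "e \<in> target_alg" "e * e = e" using be by (simp_all add: base_idempotent_def)
  define J where "J = {x \<in> source_alg. e * x = x \<and> x * z = 0}"
  have J: "subspace J"
    using subspace_source unfolding subspace_def J_def
    by (auto simp: algebra_simps scale_mult_left scale_mult_right)
  have J_ideal: "w * x \<in> J" "x * w \<in> J" if x: "x \<in> J" and w: "w \<in> source_alg" for x w
  proof -
    have "e * (w * x) = w * (e * x)"
      by (simp only: mult.assoc[symmetric] base_idempotent_commute(1)[OF be w])
    then have "e * (w * x) = w * x" using x by (simp add: J_def)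
    then show "w * x \<in> J" using x w by (simp add: J_def mult.assoc)
    have "x * w * z = x * z * w"
      using source_target_commute[OF w z(1)] by (simp add: mult.assoc)
    then show "x * w \<in> J" using x w by (simp add: J_def mult.assoc[symmetric])
  qed
  have "J \<subseteq> source_alg" by (auto simp: J_def)
  then obtain j where jJ: "j \<in> J" and unit: "\<And>x. x \<in> J \<Longrightarrow> x * j = x"
      and central: "\<And>y. y \<in> source_alg \<Longrightarrow> y * j = j * y"
    using ideal_has_central_unit[OF J _ J_ideal] by metis
  have j: "j \<in> source_alg" "e * j = j" "j * z = 0" "j * j = j"
    using jJ unit by (auto simp: J_def)
  have "j \<noteq> 0" using unit[of y] y yz nz by (auto simp: J_def)
  define w where "w = target_map j"
  have w: "w \<in> target_alg" "e * w = w"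
    using target_map_mult_target[OF e'(2), of j] by (simp_all add: w_def j)
  have ew: "e - w \<in> target_alg" "e * (e - w) = e - w"
    using e' w by (auto intro: subspace_diff subspace_target simp: right_diff_distrib)
  obtain \<phi> where \<phi>: "functional \<phi>" "e - w = (\<Sum>i\<in>one_support. scale (\<phi> (z * leg1 i)) (leg2 i))"
  proof (rule slice_orthogonal[OF be z ew])
    fix x assume x: "x \<in> source_alg" "e * x = x" "x * z = 0"
    then have "x * j = x" by (intro unit) (simp add: J_def)
    then have "\<epsilon> (x * w) = \<epsilon> x" by (simp add: w_def counit_mult_target_map)
    moreover have "x * e = x" using x base_idempotent_commute(1)[OF be x(1)] by simp
    ultimately show "\<epsilon> (x * (e - w)) = 0" by (simp add: right_diff_distrib counit_diff)
  qed
  have "j * (e - w) = 0"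
  proof -
    have f: "bilinear scale (\<lambda>a b. scale (\<phi> a) b)"
      using \<phi>(1) by (simp add: multilinear_simps functional_iff mult.commute)
    have "j * (e - w) = (\<Sum>i\<in>one_support. scale (\<phi> (leg1 i * z)) (j * leg2 i))"
      by (simp add: \<phi>(2) sum_distrib_left scale_mult_right source_target_commute[OF leg1_in z(1)])
    also have "\<dots> = sweedler scale (\<lambda>a b. scale (\<phi> a) b) (j * z)"
      by (rule H.comult_source_mult_target[OF f j(1) z(1), symmetric])
    also have "\<dots> = 0"
    proof -
      interpret L: Vector_Spaces.linear scale scale "sweedler scale (\<lambda>a b. scale (\<phi> a) b)"
        by (rule H.linear_sweedler[OF f])
      show ?thesis by (simp add: j)
    qed
    finally show ?thesis .
  qed
  then have jw: "j * w = j"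
    using base_idempotent_commute(1)[OF be j(1)] j(2) by (simp add: right_diff_distrib)
  \<comment> \<open>Here \<open>S j = w\<close>, while \<open>S (j * w) = source_map w * S j\<close> and \<open>source_map w = j\<close>.\<close>
  have "w = S (j * w)" unfolding jw by (simp add: antipode_source j w_def)
  also have "\<dots> = j * w"
    using antipode_source_mult_target[OF j(1) w(1)] source_map_target_map_central[OF j(1) central]
    by (simp add: w_def)
  finally have "w = j" by (simp add: jw)
  then have "base_idempotent j" using j w by (simp add: base_idempotent_def)
  then have "j = e" using e j \<open>j \<noteq> 0\<close> by (auto simp: primitive_base_idempotent_def)
  then show False using j(3) z(2) nz by simp
qed

text \<open>
  The coideal \<open>e H\<^sub>t\<close> is simple: every nonzero element generates it.
\<close>

lemma primitive_slices:
  assumes e: "primitive_base_idempotent e" and z: "z \<in> target_alg" "e * z = z" "z \<noteq> 0"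
    and z': "z' \<in> target_alg" "e * z' = z'"
  obtains \<phi> where "functional \<phi>" "z' = (\<Sum>i\<in>one_support. scale (\<phi> (z * leg1 i)) (leg2 i))"
proof (rule slice_orthogonal[OF _ z(1,2) z'])
  show "base_idempotent e" using e by (simp add: primitive_base_idempotent_def)
  show "\<epsilon> (x * z') = 0" if "x \<in> source_alg" "e * x = x" "x * z = 0" for x
    using primitive_no_zero_divisors[OF e that(1,2) z(1,2) that(3)] z(3) by simp
qed (rule that)

section \<open>Group-like elements and trivial group-like elements\<close>

abbreviation grouplike :: "'h \<Rightarrow> bool" where "grouplike \<equiv> group_like scale \<Delta>"

text \<open>
  If \<open>y * y' = 1\<close>, then \<open>\<Delta> 1 = (1 \<otimes> y) \<Delta> y'\<close>, so that \<open>\<Delta> y' = (1 \<otimes> y') \<Delta> 1\<close> and \<open>y'\<close> is its own counital image.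
\<close>

lemma source_inverse:
  assumes y: "y \<in> source_alg" and inv: "mult_inverses y y'"
  shows "y' \<in> source_alg"
proof -
  have f: "bilinear scale (\<lambda>a b. scale (\<epsilon> (y' * b)) a)"
     "bilinear scale (\<lambda>a b. scale (\<epsilon> b) a)"
    by (simp_all add: multilinear_simps)
  have "source_map y' = sweedler scale (\<lambda>a b. scale (\<epsilon> (y' * b)) a) (y * y')"
    using inv by (simp add: source_map_def mult_inverses_def)
  also have "\<dots> = (\<Sum>i\<in>one_support. sweedler scale (\<lambda>a' b'. scale (\<epsilon> (y' * (y * leg2 i * b'))) (leg1 i * a')) y')"
    by (simp add: H.sweedler_mult[OF f(1)] H.comult_source(2)[OF H.bilinear_sweedler_mult[OF f(1)] y])
  also have "\<dots> = (\<Sum>i\<in>one_support. sweedler scale (\<lambda>a' b'. scale (\<epsilon> (leg2 i * b')) (leg1 i * a')) y')"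
    using inv by (simp add: mult.assoc[symmetric] mult_inverses_def)
  also have "\<dots> = sweedler scale (\<lambda>a b. scale (\<epsilon> b) a) (1 * y')"
    unfolding H.sweedler_mult[OF f(2)]
    using H.bilinear_sweedler_mult[OF f(2), of y'] by (simp add: H.sweedler_one_legs)
  also have "\<dots> = y'" by (simp add: counit_right')
  finally show ?thesis by (metis source_map_in)
qed

end

context weak_hopf_algebra_eval
begin

lemma sweedler_group_like:
  assumes f: "bilinear sc f" and g: "grouplike g"
  shows "sweedler sc f g = (\<Sum>i\<in>one_support. f (g * leg1 i) (g * leg2 i))"
    and "sweedler sc f g = (\<Sum>i\<in>one_support. f (leg1 i * g) (leg2 i * g))"
proof -
  have f': "bilinear sc (\<lambda>a b. f (g * a) (g * b))" "bilinear sc (\<lambda>a b. f (a * g) (b * g))"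
    using f by (simp_all add: multilinear_simps)
  have "\<Delta> g = mult2 scale (pure2 scale g g) (\<Delta> 1)" "\<Delta> g = mult2 scale (\<Delta> 1) (pure2 scale g g)"
    using g unfolding group_like_def by blast+
  then show "sweedler sc f g = (\<Sum>i\<in>one_support. f (g * leg1 i) (g * leg2 i))"
    and "sweedler sc f g = (\<Sum>i\<in>one_support. f (leg1 i * g) (leg2 i * g))"
    using eval_pure_mult_comult[OF f, of g g 1] eval_comult_mult_pure[OF f, of 1 g g]
    by (simp_all add: sweedler_def[of sc f g] sweedler_one_legs f')
qed

text \<open>
  Since \<open>\<Delta> 1\<close> is a left unit for \<open>\<Delta> h\<close>, the factor \<open>\<Delta> 1\<close> of \<open>\<Delta> g\<close> is absorbed.
\<close>

lemma sweedler_group_like_mult: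
  assumes f: "bilinear sc f" and g: "grouplike g"
  shows "sweedler sc f (g * h) = sweedler sc (\<lambda>a b. f (g * a) (g * b)) h"
proof -
  have f': "bilinear sc (\<lambda>a b. f (g * a) (g * b))" using f by (simp add: multilinear_simps)
  have "sweedler sc f (g * h) = sweedler sc (\<lambda>a b. f (g * a) (g * b)) (1 * h)"
    unfolding sweedler_mult[OF f] sweedler_mult[OF f'] sweedler_group_like(1)[OF bilinear_sweedler_mult[OF f] g]
    by (subst sweedler_one_legs[OF bilinear_sweedler_mult[OF f']]) (simp add: mult.assoc)
  then show ?thesis by simp
qed

lemma sweedler_mult_group_like:
  assumes f: "bilinear sc f" and g: "grouplike g"
  shows "sweedler sc f (h * g) = sweedler sc (\<lambda>a b. f (a * g) (b * g)) h"
proof -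
  have f': "bilinear sc (\<lambda>a b. f (a * g) (b * g))" using f by (simp add: multilinear_simps)
  have f2: "bilinear sc (\<lambda>a' b'. f (a * a') (b * b'))"
    "bilinear sc (\<lambda>a' b'. f (a * (a' * g)) (b * (b' * g)))" for a b
    using f by (simp_all add: multilinear_simps)
  have "sweedler sc f (h * g) = sweedler sc (\<lambda>a b. f (a * g) (b * g)) (h * 1)"
    unfolding sweedler_mult[OF f] sweedler_mult[OF f']
    by (simp add: sweedler_group_like(2)[OF f2(1) g] sweedler_one_legs[OF f2(2)] mult.assoc)
  then show ?thesis by simp
qed

end

context weak_hopf_algebra
begin

lemma group_likeI:
  assumes "mult_inverses g g'"
    and "\<And>f :: 'h \<Rightarrow> 'h \<Rightarrow> 'k. bilinear (*) f \<Longrightarrow> sweedler (*) f g = sweedler (*) (\<lambda>a b. f (g * a) (g * b)) 1"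
    and "\<And>f :: 'h \<Rightarrow> 'h \<Rightarrow> 'k. bilinear (*) f \<Longrightarrow> sweedler (*) f g = sweedler (*) (\<lambda>a b. f (a * g) (b * g)) 1"
  shows "grouplike g"
proof -
  let ?m = "\<lambda>(a, b) (a', b'). (a * a', b * b')"
  have eval: "linear_extension (*) (\<lambda>(a, b). f a b) x = induced (*) (\<lambda>(a, b). f a b) (class2 scale x)"
    if "bilinear (*) f" for f :: "'h \<Rightarrow> 'h \<Rightarrow> 'k" and x
    by (rule induced_class2[OF K.W.vector_space_axioms that, symmetric])
  have "\<Delta> g = class2 scale (free_mult ?m (rep (pure2 scale g g)) (rep (\<Delta> 1)))"
  proof (rule comult_eqI)
    fix f :: "'h \<Rightarrow> 'h \<Rightarrow> 'k" assume f: "bilinear (*) f"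
    show "sweedler (*) f g = linear_extension (*) (\<lambda>(a, b). f a b)
        (free_mult ?m (rep (pure2 scale g g)) (rep (\<Delta> 1)))"
      unfolding eval[OF f] mult2_def[symmetric] K.eval_pure_mult_comult[OF f] by (rule assms(2)[OF f])
  qed
  moreover have "\<Delta> g = class2 scale (free_mult ?m (rep (\<Delta> 1)) (rep (pure2 scale g g)))"
  proof (rule comult_eqI)
    fix f :: "'h \<Rightarrow> 'h \<Rightarrow> 'k" assume f: "bilinear (*) f"
    show "sweedler (*) f g = linear_extension (*) (\<lambda>(a, b). f a b)
        (free_mult ?m (rep (\<Delta> 1)) (rep (pure2 scale g g)))"
      unfolding eval[OF f] mult2_def[symmetric] K.eval_comult_mult_pure[OF f] by (rule assms(3)[OF f])
  qed
  ultimately show ?thesis using assms(1) by (auto simp: group_like_def mult2_def)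
qed

lemma group_like_mult:
  assumes g: "grouplike g" and h: "grouplike h"
  shows "grouplike (g * h)"
proof -
  obtain g' h' where inv: "mult_inverses g g'" "mult_inverses h h'"
    using g h by (auto simp: group_like_def)
  have "(g * h) * (h' * g') = g * (h * h') * g'" "(h' * g') * (g * h) = h' * (g' * g) * h"
    by (simp_all only: mult.assoc)
  then have "mult_inverses (g * h) (h' * g')" using inv by (simp add: mult_inverses_def)
  then show ?thesis
  proof (rule group_likeI)
    fix f :: "'h \<Rightarrow> 'h \<Rightarrow> 'k" assume f: "bilinear (*) f"
    have f': "bilinear (*) (\<lambda>a b. f (g * a) (g * b))" "bilinear (*) (\<lambda>a b. f (a * h) (b * h))"
      using f by (simp_all add: multilinear_simps)
    show "sweedler (*) f (g * h) = sweedler (*) (\<lambda>a b. f (g * h * a) (g * h * b)) 1"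
      using K.sweedler_group_like_mult[OF f g, of h] K.sweedler_group_like_mult[OF f'(1) h, of 1]
      by (simp add: mult.assoc)
    show "sweedler (*) f (g * h) = sweedler (*) (\<lambda>a b. f (a * (g * h)) (b * (g * h))) 1"
      using K.sweedler_mult_group_like[OF f h, of g] K.sweedler_mult_group_like[OF f'(2) g, of 1]
      by (simp add: mult.assoc)
  qed
qed

lemma group_like_inverse:
  assumes g: "grouplike g" and inv: "mult_inverses g g'"
  shows "grouplike g'"
proof (rule group_likeI[of g' g])
  show "mult_inverses g' g" using inv by (simp add: mult_inverses_def)
  have c: "g' * (g * x) = x" "x * g * g' = x" for x
    using inv by (simp_all add: mult_inverses_def mult.assoc[symmetric])
      (simp add: mult_inverses_def mult.assoc)
  fix f :: "'h \<Rightarrow> 'h \<Rightarrow> 'k" assume f: "bilinear (*) f"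
  have f': "bilinear (*) (\<lambda>a b. f (g' * a) (g' * b))" "bilinear (*) (\<lambda>a b. f (a * g') (b * g'))"
    using f by (simp_all add: multilinear_simps)
  show "sweedler (*) f g' = sweedler (*) (\<lambda>a b. f (g' * a) (g' * b)) 1"
    using K.sweedler_group_like_mult[OF f'(1) g, of g'] inv by (simp add: c mult_inverses_def)
  show "sweedler (*) f g' = sweedler (*) (\<lambda>a b. f (a * g') (b * g')) 1"
    using K.sweedler_mult_group_like[OF f'(2) g, of g'] inv by (simp add: c mult_inverses_def)
qed

lemma target_map_group_like:
  assumes g: "grouplike g"
  shows "target_map g = 1"
proof -
  obtain g' where inv: "mult_inverses g g'" using g by (auto simp: group_like_def)
  have f: "bilinear scale (\<lambda>a b. scale (\<epsilon> a) b)" by (simp add: multilinear_simps)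
  have "target_map g * g = (\<Sum>i\<in>one_support. scale (\<epsilon> (leg1 i * g)) (leg2 i * g))"
    by (simp add: target_map_legs sum_distrib_right scale_mult_left)
  also have "\<dots> = g"
    using H.sweedler_group_like(2)[OF f g] by (simp add: counit_left')
  finally have "target_map g * g * g' = g * g'" by simp
  then show ?thesis using inv by (simp add: mult.assoc mult_inverses_def)
qed

abbreviation trivial_group_like :: "'h set" where
  "trivial_group_like \<equiv> trivial_group_likes scale \<Delta> \<epsilon> S"

text \<open>
  The condition \<open>target_map (y * w) = 1\<close> reads \<open>w * S y = 1\<close>, which determines \<open>w\<close>.
\<close>

lemma trivial_group_likeI:
  assumes u: "grouplike (y * w)" and y: "y \<in> source_alg" "mult_inverses y y'" and w: "w \<in> target_alg"
  shows "y * w \<in> trivial_group_like"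
proof -
  have y': "y' \<in> source_alg" by (rule source_inverse[OF y])
  have "w * target_map y = target_map (y * w)"
    using target_map_mult_target[OF w, of y] source_target_commute[OF y(1) w] by simp
  also have "\<dots> = 1" by (rule target_map_group_like[OF u])
  finally have "w * target_map y = 1" .
  moreover have "target_map y * target_map y' = 1"
    using target_map_mult_source[OF y' y(1)] y(2) by (simp add: mult_inverses_def)
  ultimately have "w = target_map y'" by (metis mult.assoc mult_1_left mult_1_right)
  then have "y * w = S y' * y"
    using source_target_commute[OF y(1) w] by (simp add: antipode_source y')
  moreover have "mult_inverses y' y" using y(2) by (simp add: mult_inverses_def)
  ultimately show ?thesis
    using u y' by (auto simp: trivial_group_likes_def source_alg_eq[symmetric])
qed

lemma trivial_group_likeE:
  assumes "u \<in> trivial_group_like"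
  obtains y y' where "grouplike u" "y \<in> source_alg" "y' \<in> source_alg" "mult_inverses y y'"
    "u = y' * target_map y"
proof -
  obtain y y' where *: "grouplike u" "y \<in> source_alg" "mult_inverses y y'" "u = S y * y'"
    using assms by (auto simp: trivial_group_likes_def source_alg_eq[symmetric])
  have y': "y' \<in> source_alg" by (rule source_inverse[OF *(2,3)])
  have "u = y' * target_map y"
    unfolding *(4) antipode_source[OF *(2)] by (rule source_target_commute[OF y' target_map_in, symmetric])
  then show thesis using that * y' by blast
qed

lemma trivial_group_like_mult:
  assumes "u \<in> trivial_group_like" "v \<in> trivial_group_like"
  shows "u * v \<in> trivial_group_like"
proof -
  obtain x x' where u: "grouplike u" "x \<in> source_alg" "x' \<in> source_alg" "mult_inverses x x'"
      "u = x' * target_map x"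
    using assms(1) by (rule trivial_group_likeE)
  obtain y y' where v: "grouplike v" "y \<in> source_alg" "y' \<in> source_alg" "mult_inverses y y'"
      "v = y' * target_map y"
    using assms(2) by (rule trivial_group_likeE)
  have "u * v = x' * (target_map x * y') * target_map y"
    by (simp only: u v mult.assoc)
  also have "\<dots> = (x' * y') * (target_map x * target_map y)"
    by (simp add: source_target_commute[OF v(3) target_map_in, symmetric] mult.assoc)
  finally have uv: "u * v = (x' * y') * (target_map x * target_map y)" .
  have "x' * y' * (y * x) = x' * (y' * y) * x" "y * x * (x' * y') = y * (x * x') * y'"
    by (simp_all only: mult.assoc)
  then have "mult_inverses (x' * y') (y * x)"
    using u v by (simp add: mult_inverses_def)
  then show ?thesis
    unfolding uv using group_like_mult[OF u(1) v(1)] u v uv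
    by (intro trivial_group_likeI) auto
qed

lemma trivial_group_like_inverse:
  assumes "u \<in> trivial_group_like" "mult_inverses u u'"
  shows "u' \<in> trivial_group_like"
proof -
  obtain y y' where u: "grouplike u" "y \<in> source_alg" "y' \<in> source_alg" "mult_inverses y y'"
      "u = y' * target_map y"
    using assms(1) by (rule trivial_group_likeE)
  have "u * (y * target_map y') = y' * (target_map y * y) * target_map y'"
    by (simp only: u mult.assoc)
  also have "\<dots> = (y' * y) * (target_map y * target_map y')"
    by (simp add: source_target_commute[OF u(2) target_map_in, symmetric] mult.assoc)
  also have "\<dots> = 1"
    using u by (simp add: target_map_mult_source[symmetric] mult_inverses_def)
  finally have "u * (y * target_map y') = 1" .
  then have "u' = y * target_map y'"
    using assms(2) unfolding mult_inverses_def by (metis mult.assoc mult_1_left mult_1_right)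
  then show ?thesis
    using group_like_inverse[OF u(1) assms(2)] u by (auto intro: trivial_group_likeI)
qed

section \<open>Group-like elements related over an idempotent\<close>

text \<open>
  The coideals \<open>g e H\<^sub>t\<close> and \<open>h e H\<^sub>t\<close> are isomorphic: right multiplication by \<open>y\<close> maps the second to the first,
  and \<open>y'\<close>, \<open>z'\<close> are inverses of \<open>y\<close>, \<open>z\<close> relative to the unit \<open>e\<close>.
\<close>

definition related_over :: "'h \<Rightarrow> 'h \<Rightarrow> 'h \<Rightarrow> bool" where
  "related_over e g h \<longleftrightarrow> (\<exists>y\<in>source_alg. \<exists>y'\<in>source_alg. \<exists>z\<in>target_alg. \<exists>z'\<in>target_alg.
     e * y = y \<and> e * y' = y' \<and> e * z = z \<and> e * z' = z' \<and>
     y * y' = e \<and> y' * y = e \<and> z * z' = e \<and> z' * z = e \<and> g * z = h * y)"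

lemma related_over_refl:
  assumes "base_idempotent e" "g * e = h * e"
  shows "related_over e g h"
  using assms unfolding related_over_def base_idempotent_def by blast

lemma related_over_sym:
  assumes "related_over e g h"
  shows "related_over e h g"
proof -
  obtain y y' z z' where *: "y \<in> source_alg" "y' \<in> source_alg" "z \<in> target_alg" "z' \<in> target_alg"
     "e * y = y" "e * y' = y'" "e * z = z" "e * z' = z'"
     "y * y' = e" "y' * y = e" "z * z' = e" "z' * z = e" "g * z = h * y"
    using assms unfolding related_over_def by blast
  have "g * y' = g * (z * z') * y'" by (simp add: * mult.assoc)
  also have "\<dots> = h * y * (z' * y')" by (simp only: *(13) mult.assoc[symmetric])
  also have "\<dots> = h * (y * y') * z'"
    by (simp only: source_target_commute[OF *(2,4), symmetric] mult.assoc)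
  finally have "h * z' = g * y'" by (simp add: * mult.assoc)
  then show ?thesis using * unfolding related_over_def by blast
qed

lemma related_over_trans:
  assumes gh: "related_over e g h" and hk: "related_over e h k"
  shows "related_over e g k"
proof -
  obtain y y' z z' where *: "y \<in> source_alg" "y' \<in> source_alg" "z \<in> target_alg" "z' \<in> target_alg"
     "e * y = y" "e * y' = y'" "e * z = z" "e * z' = z'"
     "y * y' = e" "y' * y = e" "z * z' = e" "z' * z = e" "g * z = h * y"
    using gh unfolding related_over_def by blast
  obtain x x' w w' where **: "x \<in> source_alg" "x' \<in> source_alg" "w \<in> target_alg" "w' \<in> target_alg"
     "e * x = x" "e * x' = x'" "e * w = w" "e * w' = w'"
     "x * x' = e" "x' * x = e" "w * w' = e" "w' * w = e" "h * w = k * x"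
    using hk unfolding related_over_def by blast
  have "g * (z * w) = h * (y * w)" by (simp only: *(13) mult.assoc[symmetric])
  also have "\<dots> = h * w * y" by (simp only: source_target_commute[OF *(1) **(3)] mult.assoc)
  also have "\<dots> = k * (x * y)" by (simp only: **(13) mult.assoc)
  finally have eq: "g * (z * w) = k * (x * y)" .
  have "x * y * (y' * x') = x * (y * y') * x'" "y' * x' * (x * y) = y' * (x' * x) * y"
    "z * w * (w' * z') = z * (w * w') * z'" "w' * z' * (z * w) = w' * (z' * z) * w"
    by (simp_all only: mult.assoc)
  then have inv: "x * y * (y' * x') = e" "y' * x' * (x * y) = e" "z * w * (w' * z') = e" "w' * z' * (z * w) = e"
    by (simp_all add: * ** mult.assoc)
  show ?thesis
    unfolding related_over_def
    by (rule bexI[of _ "x * y"], rule bexI[of _ "y' * x'"], rule bexI[of _ "z * w"], rule bexI[of _ "w' * z'"])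
      (use * ** in \<open>simp_all add: inv eq, simp_all add: mult.assoc[symmetric]\<close>)
qed

text \<open>
  An isomorphism over \<open>c\<close> and one over \<open>e - c\<close> add up, since the mixed products vanish by orthogonality.
\<close>

lemma related_over_split:
  assumes e: "base_idempotent e" and c: "base_idempotent c" "e * c = c"
    and R: "related_over c g h" "related_over (e - c) g h"
  shows "related_over e g h"
proof -
  define d where "d = e - c"
  obtain y y' z z' where *: "y \<in> source_alg" "y' \<in> source_alg" "z \<in> target_alg" "z' \<in> target_alg"
     "c * y = y" "c * y' = y'" "c * z = z" "c * z' = z'"
     "y * y' = c" "y' * y = c" "z * z' = c" "z' * z = c" "g * z = h * y"
    using R(1) unfolding related_over_def by blast
  obtain x x' w w' where **: "x \<in> source_alg" "x' \<in> source_alg" "w \<in> target_alg" "w' \<in> target_alg"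
     "d * x = x" "d * x' = x'" "d * w = w" "d * w' = w'"
     "x * x' = d" "x' * x = d" "w * w' = d" "w' * w = d" "g * w = h * x"
    using R(2) unfolding related_over_def d_def by blast
  have ee: "e \<in> source_alg" "e * e = e" and cc: "c \<in> source_alg" "c * c = c"
    using e c by (simp_all add: base_idempotent_def)
  have ce: "c * e = c" using base_idempotent_commute(1)[OF e cc(1)] c(2) by simp
  have cd: "c * d = 0" "d * c = 0" "e * d = d"
    by (simp_all add: d_def algebra_simps ee cc c(2) ce)
  have d: "base_idempotent d"
    using e c subspace_diff[OF subspace_source] subspace_diff[OF subspace_target]
    by (auto simp: base_idempotent_def d_def algebra_simps ce)
  have cross: "p * q = 0" "q * p = 0"
    if p: "p \<in> source_alg \<or> p \<in> target_alg" "c * p = p" and q: "q \<in> source_alg \<or> q \<in> target_alg" "d * q = q" for p q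
  proof -
    have "p * c = p" "q * d = q"
      using p q base_idempotent_commute[OF c(1)] base_idempotent_commute[OF d] by auto
    then have "p * q = p * (c * d) * q" "q * p = q * (d * c) * p"
      using p(2) q(2) by (metis mult.assoc)+
    then show "p * q = 0" "q * p = 0" by (simp_all add: cd)
  qed
  have e_fix: "e * p = p" if "c * p = p" for p using that c(2) by (metis mult.assoc)
  have e_fix': "e * p = p" if "d * p = p" for p using that cd(3) by (metis mult.assoc)
  have sum: "c + d = e" by (simp add: d_def)
  have in_alg: "y + x \<in> source_alg" "y' + x' \<in> source_alg" "z + w \<in> target_alg" "z' + w' \<in> target_alg"
    using * ** subspace_add[OF subspace_source] subspace_add[OF subspace_target] by auto
  have fixed: "e * (y + x) = y + x" "e * (y' + x') = y' + x'" "e * (z + w) = z + w" "e * (z' + w') = z' + w'"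
    by (simp_all only: distrib_left e_fix * e_fix' **)
  have inv: "(p + q) * (p' + q') = e"
    if "p * p' = c" "q * q' = d" "p * q' = 0" "q * p' = 0" for p q p' q'
    by (simp add: distrib_left distrib_right that sum)
  have prods: "(y + x) * (y' + x') = e" "(y' + x') * (y + x) = e"
      "(z + w) * (z' + w') = e" "(z' + w') * (z + w) = e"
    by (rule inv; (rule * | rule ** | rule cross; (rule disjI1, rule * | rule disjI1, rule ** | rule disjI2, rule *
        | rule disjI2, rule ** | rule * | rule **)))+
  have "g * (z + w) = h * (y + x)" by (simp only: distrib_left *(13) **(13))
  then show ?thesis
    unfolding related_over_def using in_alg fixed prods by blast
qed

lemma related_over_one_imp_trivial:
  assumes R: "related_over 1 g h" and h: "grouplike h" "mult_inverses h h'" and g: "grouplike g"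
  shows "h' * g \<in> trivial_group_like"
proof -
  obtain y y' z z' where *: "y \<in> source_alg" "y' \<in> source_alg" "z \<in> target_alg" "z' \<in> target_alg"
     "y * y' = 1" "y' * y = 1" "z * z' = 1" "g * z = h * y"
    using R unfolding related_over_def by blast
  have "h' * g = h' * g * (z * z')" by (simp add: *(7))
  also have "\<dots> = h' * (g * z) * z'" by (simp only: mult.assoc)
  also have "\<dots> = h' * h * y * z'" by (simp only: *(8) mult.assoc)
  finally have eq: "h' * g = y * z'" using h by (simp add: mult_inverses_def)
  have "grouplike (h' * g)" using group_like_inverse[OF h] g by (rule group_like_mult)
  then show ?thesis
    unfolding eq by (rule trivial_group_likeI[of y z' y']) (use * in \<open>simp_all add: mult_inverses_def\<close>)
qed

section \<open>Finiteness of the number of classes\<close>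

lemma sweedler_group_like_mult_target:
  assumes f: "bilinear scale f" and g: "grouplike g" and z: "z \<in> target_alg"
  shows "sweedler scale f (g * z) = (\<Sum>i\<in>one_support. f (g * z * leg1 i) (g * leg2 i))"
proof -
  have "bilinear scale (\<lambda>a b. f (g * a) (g * b))" using f by (simp add: multilinear_simps)
  from H.comult_target(1)[OF this z] show ?thesis
    by (simp add: H.sweedler_group_like_mult[OF f g] mult.assoc)
qed

text \<open>
  The relations \<open>\<Sum>g. g * z g = 0\<close> are stable under the action of the functionals on the coideals \<open>g H\<^sub>t\<close>: apply \<open>\<phi> \<otimes> id\<close> to the
  comultiplication of the relation.
\<close>

lemma slice_relation:
  assumes X: "\<And>g. g \<in> X \<Longrightarrow> grouplike g" and z: "\<And>g. g \<in> X \<Longrightarrow> z g \<in> target_alg"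
    and sum: "(\<Sum>g\<in>X. g * z g) = 0" and \<phi>: "functional \<phi>"
  shows "(\<Sum>g\<in>X. g * (\<Sum>i\<in>one_support. scale (\<phi> (g * z g * leg1 i)) (leg2 i))) = 0"
proof -
  have f: "bilinear scale (\<lambda>a b. scale (\<phi> a) b)"
    using \<phi> by (simp add: multilinear_simps functional_iff mult.commute)
  interpret L: Vector_Spaces.linear scale scale "sweedler scale (\<lambda>a b. scale (\<phi> a) b)"
    by (rule H.linear_sweedler[OF f])
  have "0 = (\<Sum>g\<in>X. sweedler scale (\<lambda>a b. scale (\<phi> a) b) (g * z g))"
    using L.sum[of "\<lambda>g. g * z g" X] sum by simp
  also have "\<dots> = (\<Sum>g\<in>X. \<Sum>i\<in>one_support. scale (\<phi> (g * z g * leg1 i)) (g * leg2 i))"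
    by (intro sum.cong refl sweedler_group_like_mult_target f X z)
  finally show ?thesis by (simp add: sum_distrib_left scale_mult_right)
qed

lemma slice_in_target:
  assumes "base_idempotent e" "z \<in> target_alg" "e * z = z" "functional \<phi>"
  shows "(\<Sum>i\<in>one_support. scale (\<phi> (g * z * leg1 i)) (leg2 i)) \<in> target_alg" (is "?w \<in> _")
    and "e * (\<Sum>i\<in>one_support. scale (\<phi> (g * z * leg1 i)) (leg2 i))
      = (\<Sum>i\<in>one_support. scale (\<phi> (g * z * leg1 i)) (leg2 i))"
proof -
  show "?w \<in> target_alg" by (intro subspace_sum subspace_scale subspace_target leg2_in)
  have f: "bilinear scale (\<lambda>a b. scale (\<phi> (g * z * a)) b)"
    using assms(4) by (simp add: multilinear_simps functional_iff mult.commute)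
  have "z * (e * x) = z * x" for x
    using base_idempotent_commute(2)[OF assms(1,2)] assms(3) by (simp add: mult.assoc[symmetric])
  then have "?w = (\<Sum>i\<in>one_support. scale (\<phi> (g * z * (e * leg1 i))) (leg2 i))"
    by (simp add: mult.assoc)
  also have "\<dots> = e * ?w"
    unfolding sum_legs_base_idempotent[OF f assms(1)] by (simp add: sum_distrib_left scale_mult_right)
  finally show "e * ?w = ?w" by simp
qed

text \<open>
  Apply the counit to the slice: \<open>g * z = \<Sum>i. \<epsilon> (v i) (g * z * u i)\<close>.
\<close>

lemma slice_eq_0_imp:
  assumes "z \<in> target_alg" "functional \<phi>"
    and "(\<Sum>i\<in>one_support. scale (\<phi> (g * z * leg1 i)) (leg2 i)) = 0"
  shows "\<phi> (g * z) = 0"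
proof -
  have f: "bilinear scale (\<lambda>a b. scale (\<epsilon> b) a)" by (simp add: multilinear_simps)
  have "z = (\<Sum>i\<in>one_support. scale (\<epsilon> (leg2 i)) (z * leg1 i))"
    using H.comult_target(1)[OF f assms(1)] by (simp add: counit_right')
  then have "g * z = (\<Sum>i\<in>one_support. scale (\<epsilon> (leg2 i)) (g * z * leg1 i))"
    by (metis (no_types, lifting) mult.assoc scale_mult_right sum.cong sum_distrib_left)
  then have "\<phi> (g * z) = (\<Sum>i\<in>one_support. \<epsilon> (leg2 i) * \<phi> (g * z * leg1 i))"
    by (metis (no_types, lifting) functional_simps(2,3)[OF assms(2)] sum.cong)
  also have "\<dots> = \<epsilon> (\<Sum>i\<in>one_support. scale (\<phi> (g * z * leg1 i)) (leg2 i))"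
    by (simp add: counit_sum counit_scale mult.commute)
  finally show ?thesis by (simp add: assms(3))
qed

end

locale finite_dimensional_weak_hopf_algebra =
  weak_hopf_algebra scale \<Delta> \<epsilon> S + finite_dimensional_vector_space scale Basis
  for scale :: "'k::field \<Rightarrow> 'h::{ring,monoid_mult} \<Rightarrow> 'h" and \<Delta> \<epsilon> S Basis
begin

text \<open>
  An injective linear endomorphism of a finite-dimensional space is surjective.
\<close>

lemma inverse_in_subalgebra:
  assumes V: "subspace V" "\<And>x y. x \<in> V \<Longrightarrow> y \<in> V \<Longrightarrow> x * y \<in> V"
    and e: "e \<in> V" "\<And>x. x \<in> V \<Longrightarrow> e * x = x" "\<And>x. x \<in> V \<Longrightarrow> x * e = x"
    and x: "x \<in> V" and inj: "\<And>v. v \<in> V \<Longrightarrow> x * v = 0 \<Longrightarrow> v = 0"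
  obtains x' where "x' \<in> V" "x * x' = e" "x' * x = e"
proof -
  interpret P: finite_dimensional_vector_space_pair scale Basis scale Basis ..
  have V_span: "span V = V" using V(1) by (simp add: span_eq_iff)
  have "inj_on ((*) x) V"
  proof (rule inj_onI)
    fix a b assume ab: "a \<in> V" "b \<in> V" "x * a = x * b"
    then have "x * (a - b) = 0" by (simp add: right_diff_distrib)
    then show "a = b" using inj[of "a - b"] ab subspace_diff[OF V(1)] by auto
  qed
  then have "dim ((*) x ` V) = dim V"
    using P.dim_image_eq[OF linear_mult_left, of x V] V_span by simp
  moreover have "(*) x ` V \<subseteq> V" using V(2) x by auto
  moreover have "subspace ((*) x ` V)" by (rule P.linear_subspace_image[OF linear_mult_left V(1)])
  ultimately have "(*) x ` V = V"
    using subspace_dim_equal[of "(*) x ` V" V] V(1) by simp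
  then have "e \<in> (*) x ` V" using e(1) by simp
  then obtain x' where x': "x' \<in> V" "x * x' = e" by auto
  have "x * (x' * x - e) = 0"
    using x' e x by (simp add: right_diff_distrib mult.assoc[symmetric])
  then have "x' * x - e = 0"
    by (rule inj[rotated]) (intro subspace_diff V x' x e)
  then show thesis using that x' by simp
qed

text \<open>
  This is Schur's lemma for the coideals \<open>g e H\<^sub>t\<close> and \<open>h e H\<^sub>t\<close>.  If \<open>g * z = h * y\<close> is nonzero, then \<open>z\<close> and \<open>y\<close> are not zero divisors in
  \<open>e H\<^sub>t\<close> and \<open>e H\<^sub>s\<close>, because either kind of relation turns into a product of nonzero elements of \<open>e H\<^sub>s\<close> and \<open>e H\<^sub>t\<close>
  that vanishes.
\<close>

lemma primitive_related:
  assumes e: "primitive_base_idempotent e" and g: "grouplike g" and h: "grouplike h"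
    and z: "z \<in> target_alg" "e * z = z" "z \<noteq> 0" and y: "y \<in> source_alg" "e * y = y"
    and eq: "g * z = h * y"
  shows "related_over e g h"
proof -
  have be: "base_idempotent e" using e by (simp add: primitive_base_idempotent_def)
  have e': "e \<in> source_alg" "e \<in> target_alg" "e * e = e" using be by (simp_all add: base_idempotent_def)
  note comm = base_idempotent_commute[OF be]
  have cancel: "x = 0" if k: "grouplike k" "k * x = 0" for k x
  proof -
    obtain k' where "mult_inverses k k'" using k(1) unfolding group_like_def by blast
    then have "x = k' * (k * x)" by (simp add: mult.assoc[symmetric] mult_inverses_def)
    then show ?thesis using k(2) by simp
  qed
  have y0: "y \<noteq> 0" using cancel[OF g, of z] z(3) eq by auto
  have sub: "subspace {v \<in> source_alg. e * v = v}" "subspace {v \<in> target_alg. e * v = v}"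
    using subspace_source subspace_target unfolding subspace_def
    by (auto simp: distrib_left scale_mult_right)
  have closed: "e * (v * w) = v * w" if "e * v = v" for v w
    using that by (simp add: mult.assoc[symmetric])
  let ?Y = "{v \<in> source_alg. e * v = v}" and ?Z = "{v \<in> target_alg. e * v = v}"
  have unit: "v * e = v" if "v \<in> ?Y \<or> v \<in> ?Z" for v
    using that comm by auto
  have mem: "e \<in> ?Y" "y \<in> ?Y" "e \<in> ?Z" "z \<in> ?Z" using e' y z by simp_all
  have clY: "v * w \<in> ?Y" if "v \<in> ?Y" "w \<in> ?Y" for v w using that closed by simp
  have clZ: "v * w \<in> ?Z" if "v \<in> ?Z" "w \<in> ?Z" for v w using that closed by simp
  have injY: "v = 0" if v: "v \<in> ?Y" "y * v = 0" for v
  proof -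
    have "g * (z * v) = h * (y * v)" using eq by (simp only: mult.assoc[symmetric])
    then have "v * z = 0" using cancel[OF g] source_target_commute[of v z] v z by simp
    then show "v = 0" using primitive_no_zero_divisors[OF e, of v z] v z by simp
  qed
  have injZ: "v = 0" if v: "v \<in> ?Z" "z * v = 0" for v
  proof -
    have "g * (z * v) = h * (y * v)" using eq by (simp only: mult.assoc[symmetric])
    then have "y * v = 0" using cancel[OF h, of "y * v"] v by simp
    then show "v = 0" using primitive_no_zero_divisors[OF e y, of v] v y0 by simp
  qed
  obtain y' where y': "y' \<in> ?Y" "y * y' = e" "y' * y = e"
    by (rule inverse_in_subalgebra[OF sub(1) clY mem(1) _ _ mem(2) injY]) (auto intro: unit)
  obtain z' where z': "z' \<in> ?Z" "z * z' = e" "z' * z = e"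
    by (rule inverse_in_subalgebra[OF sub(2) clZ mem(3) _ _ mem(4) injZ]) (auto intro: unit)
  show ?thesis
    unfolding related_over_def using y y' z z' eq by blast
qed

text \<open>
  The sum of pairwise non-isomorphic simple coideals \<open>g e H\<^sub>t\<close> is direct.  If a relation has a nonzero coefficient
  at \<open>h\<close>, simplicity allows it to be normalised to \<open>e\<close>.  A functional that vanishes on \<open>h e H\<^sub>s\<close> then yields a
  relation without \<open>h\<close>, which is zero by induction.  So any further term \<open>g * w g\<close> lies in \<open>h e H\<^sub>s\<close>, and \<open>g\<close> is related to
  \<open>h\<close> by Schur's lemma.
\<close>

lemma primitive_unrelated_independent:
  assumes e: "primitive_base_idempotent e" and "finite X"
    and "\<And>g. g \<in> X \<Longrightarrow> grouplike g"
    and "\<And>g h. g \<in> X \<Longrightarrow> h \<in> X \<Longrightarrow> g \<noteq> h \<Longrightarrow> \<not> related_over e g h"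
    and "\<And>g. g \<in> X \<Longrightarrow> z g \<in> target_alg" "\<And>g. g \<in> X \<Longrightarrow> e * z g = z g"
    and "(\<Sum>g\<in>X. g * z g) = 0" and "g \<in> X"
  shows "z g = 0"
  using assms(2-)
proof (induction X arbitrary: z g rule: finite_induct)
  case empty
  then show ?case by simp
next
  case (insert h X)
  have be: "base_idempotent e" using e by (simp add: primitive_base_idempotent_def)
  have e': "e \<in> source_alg" "e \<in> target_alg" "e * e = e" using be by (simp_all add: base_idempotent_def)
  have IH: "u k = 0" if "k \<in> X" "\<And>g. g \<in> X \<Longrightarrow> u g \<in> target_alg"
    "\<And>g. g \<in> X \<Longrightarrow> e * u g = u g" "(\<Sum>g\<in>X. g * u g) = 0" for u k
    by (rule insert.IH[OF _ _ that(2-4,1)]) (use insert.prems in auto)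
  have h: "grouplike h" using insert.prems(1) by simp
  then obtain h' where "mult_inverses h h'" unfolding group_like_def by blast
  then have h': "h' * h = 1" by (simp add: mult_inverses_def)
  have "z h = 0"
  proof (rule ccontr)
    assume "z h \<noteq> 0"
    obtain \<phi> where \<phi>: "functional \<phi>" "e = (\<Sum>i\<in>one_support. scale (\<phi> (z h * leg1 i)) (leg2 i))"
      by (rule primitive_slices[OF e, of "z h" e]) (use \<open>z h \<noteq> 0\<close> insert.prems e' in auto)
    \<comment> \<open>The functionals act on \<open>h * z h\<close>, whereas \<open>\<phi>\<close> was obtained for \<open>z h\<close>.\<close>
    define \<psi> where "\<psi> x = \<phi> (h' * x)" for x
    have \<psi>: "functional \<psi>" unfolding \<psi>_def using \<phi>(1) by (rule functional_mult_left)
    define w where "w g = (\<Sum>i\<in>one_support. scale (\<psi> (g * z g * leg1 i)) (leg2 i))" for g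
    have w: "w g \<in> target_alg" "e * w g = w g" if "g \<in> insert h X" for g
      unfolding w_def by (rule slice_in_target[OF be _ _ \<psi>] insert.prems that)+
    have w_sum: "(\<Sum>g\<in>insert h X. g * w g) = 0"
      unfolding w_def by (rule slice_relation[OF insert.prems(1,3,5) \<psi>])
    have "h' * (h * (z h * x)) = z h * x" for x using h' by (simp add: mult.assoc[symmetric])
    then have wh: "w h = e"
      using \<phi>(2) by (simp add: w_def \<psi>_def mult.assoc)
    have "e \<noteq> 0" using insert.prems(4)[of h] \<open>z h \<noteq> 0\<close> by auto
    have "\<exists>g\<in>X. w g \<noteq> 0"
    proof (rule ccontr)
      assume "\<not> ?thesis"
      then have "h * e = 0" using w_sum insert.hyps by (simp add: wh)
      then have "h' * h * e = 0" by (simp add: mult.assoc)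
      then show False using h' \<open>e \<noteq> 0\<close> by simp
    qed
    then obtain g where g: "g \<in> X" "w g \<noteq> 0" by blast
    \<comment> \<open>The coefficients \<open>w\<close> form a relation normalised at \<open>h\<close>; membership of \<open>g * w g\<close> in \<open>V\<close> is what \<open>primitive_related\<close> requires.\<close>
    define V where "V = {h * y | y. y \<in> source_alg \<and> e * y = y}"
    have V: "V = (*) h ` {y \<in> source_alg. e * y = y}" by (auto simp: V_def)
    have "subspace V"
    proof -
      interpret P: vector_space_pair scale scale ..
      have "subspace {y \<in> source_alg. e * y = y}"
        using subspace_source unfolding subspace_def by (auto simp: distrib_left scale_mult_right)
      then show ?thesis unfolding V by (rule P.linear_subspace_image[OF linear_mult_left])
    qed
    have "g * w g \<in> V"
    proof (rule ccontr)
      assume "g * w g \<notin> V"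
      then obtain \<chi> where \<chi>: "functional \<chi>" "\<forall>x\<in>V. \<chi> x = 0" "\<chi> (g * w g) = 1"
        using separating_functional[OF \<open>subspace V\<close>] by blast
      define v where "v g = (\<Sum>i\<in>one_support. scale (\<chi> (g * w g * leg1 i)) (leg2 i))" for g
      have v: "v g \<in> target_alg" "e * v g = v g" if "g \<in> insert h X" for g
        unfolding v_def by (rule slice_in_target[OF be w \<chi>(1)] that)+
      have v_sum: "(\<Sum>g\<in>insert h X. g * v g) = 0"
        unfolding v_def by (rule slice_relation[OF insert.prems(1) w(1) w_sum \<chi>(1)])
      have "\<chi> (h * e * leg1 i) = 0" for i
      proof -
        have "h * e * leg1 i = h * (e * leg1 i)" "e * (e * leg1 i) = e * leg1 i"
          using e' by (simp_all add: mult.assoc[symmetric])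
        then have "h * e * leg1 i \<in> V" using e' unfolding V_def by auto
        then show ?thesis using \<chi>(2) by blast
      qed
      then have "v h = 0" by (simp add: v_def wh)
      then have "(\<Sum>g\<in>X. g * v g) = 0" using v_sum insert.hyps by simp
      then have "v g = 0" using v by (intro IH[of g v] g(1)) simp_all
      then have "\<chi> (g * w g) = 0"
        using slice_eq_0_imp[OF w(1) \<chi>(1)] g(1) by (simp add: v_def)
      then show False using \<chi>(3) by simp
    qed
    then obtain y where "y \<in> source_alg" "e * y = y" "g * w g = h * y" by (auto simp: V_def)
    then have "related_over e g h"
      using w[of g] g h insert.prems(1) by (intro primitive_related[OF e, of g h "w g" y]) auto
    moreover have "g \<noteq> h" using g insert.hyps by auto
    ultimately show False using insert.prems(2)[of g h] g by simp
  qed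
  moreover have "z g = 0" if "g \<in> X"
  proof (rule IH[of g z, OF that])
    show "(\<Sum>g\<in>X. g * z g) = 0" using insert.prems(5) insert.hyps \<open>z h = 0\<close> by simp
  qed (use insert.prems(3,4) in simp_all)
  ultimately show ?case using insert.prems(6) by auto
qed

lemma primitive_unrelated_card:
  assumes e: "primitive_base_idempotent e" "e \<noteq> 0" and X: "finite X"
    "\<And>g. g \<in> X \<Longrightarrow> grouplike g"
    "\<And>g h. g \<in> X \<Longrightarrow> h \<in> X \<Longrightarrow> g \<noteq> h \<Longrightarrow> \<not> related_over e g h"
  shows "card X \<le> dim UNIV"
proof -
  have be: "base_idempotent e" using e by (simp add: primitive_base_idempotent_def)
  have e': "e \<in> target_alg" "e * e = e" using be by (simp_all add: base_idempotent_def)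
  have inj: "inj_on (\<lambda>g. g * e) X"
    using related_over_refl[OF be] X(3) by (auto simp: inj_on_def)
  have "independent ((\<lambda>g. g * e) ` X)"
  proof (rule independent_if_scalars_zero)
    show "finite ((\<lambda>g. g * e) ` X)" using X(1) by simp
    fix u x assume sum: "(\<Sum>x\<in>(\<lambda>g. g * e) ` X. scale (u x) x) = 0" and "x \<in> (\<lambda>g. g * e) ` X"
    then obtain g where g: "g \<in> X" "x = g * e" by auto
    have "(\<Sum>g\<in>X. g * scale (u (g * e)) e) = 0"
      using sum by (simp add: sum.reindex[OF inj] scale_mult_right)
    then have "scale (u (g * e)) e = 0"
      by (intro primitive_unrelated_independent[OF e(1) X(1) X(2) X(3) _ _ _ g(1), of "\<lambda>g. scale (u (g * e)) e"])
        (use e' in \<open>auto simp: scale_mult_right intro: subspace_scale subspace_target\<close>)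
    then show "u x = 0" using e(2) g by simp
  qed
  then have "card ((\<lambda>g. g * e) ` X) \<le> dim UNIV"
    by (intro independent_card_le_dim) auto
  then show ?thesis by (simp add: card_image inj)
qed

text \<open>
  A finite cover by sets of mutually related elements passes to common refinements more easily than a quotient set.
\<close>

definition finitely_many_classes :: "'h \<Rightarrow> bool" where
  "finitely_many_classes e \<longleftrightarrow> (\<exists>P. finite P \<and> {g. grouplike g} \<subseteq> \<Union>P
    \<and> (\<forall>C\<in>P. \<forall>g\<in>C. \<forall>h\<in>C. related_over e g h))"

text \<open>
  A set of pairwise unrelated group-like elements of maximal size represents all classes.
\<close>

lemma primitive_finitely_many_classes:
  assumes e: "primitive_base_idempotent e"
  shows "finitely_many_classes e"
proof (cases "e = 0")
  case True
  have "related_over e g h" for g h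
    using e by (intro related_over_refl) (simp_all add: True primitive_base_idempotent_def)
  then show ?thesis
    unfolding finitely_many_classes_def by (intro exI[of _ "{UNIV}"]) auto
next
  case False
  have be: "base_idempotent e" using e by (simp add: primitive_base_idempotent_def)
  define Q where "Q X \<longleftrightarrow> finite X \<and> (\<forall>g\<in>X. grouplike g)
    \<and> (\<forall>g\<in>X. \<forall>h\<in>X. g \<noteq> h \<longrightarrow> \<not> related_over e g h)" for X
  have "Q {}" by (simp add: Q_def)
  moreover have "\<forall>X. Q X \<longrightarrow> card X < Suc (dim UNIV)"
    using primitive_unrelated_card[OF e False] by (auto simp: Q_def less_Suc_eq_le)
  ultimately obtain X where X: "Q X" "\<And>Y. Q Y \<Longrightarrow> card Y \<le> card X"
    using ex_has_greatest_nat[of Q "{}" card] by blast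
  define P where "P = (\<lambda>x. {g. grouplike g \<and> related_over e g x}) ` X"
  have "finite P" using X by (simp add: P_def Q_def)
  moreover have "\<exists>x\<in>X. related_over e g x" if g: "grouplike g" for g
  proof (rule ccontr)
    assume neg: "\<not> ?thesis"
    then have "g \<notin> X" using related_over_refl[OF be, of g g] by auto
    moreover have "Q (insert g X)"
      using X(1) g neg related_over_sym by (auto simp: Q_def)
    ultimately show False using X(2)[of "insert g X"] X(1) by (simp add: Q_def)
  qed
  then have "{g. grouplike g} \<subseteq> \<Union>P" by (auto simp: P_def)
  moreover have "\<forall>C\<in>P. \<forall>g\<in>C. \<forall>h\<in>C. related_over e g h"
  proof (intro ballI)
    fix C g h assume "C \<in> P" "g \<in> C" "h \<in> C"
    then obtain x where "related_over e g x" "related_over e h x" by (auto simp: P_def)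
    then show "related_over e g h"
      by (intro related_over_trans[of e g x h] related_over_sym[of e h x])
  qed
  ultimately show ?thesis unfolding finitely_many_classes_def by blast
qed

text \<open>
  The dimension of \<open>e H\<close> decreases when \<open>e\<close> is split into two nonzero orthogonal idempotents.
\<close>

lemma base_idempotent_finitely_many_classes:
  "base_idempotent e \<Longrightarrow> finitely_many_classes e"
proof (induction "dim {x. e * x = x}" arbitrary: e rule: less_induct)
  case (less e)
  show ?case
  proof (cases "primitive_base_idempotent e")
    case True
    then show ?thesis by (rule primitive_finitely_many_classes)
  next
    case False
    then obtain c where c: "base_idempotent c" "e * c = c" "c \<noteq> 0" "c \<noteq> e"
      using less.prems by (auto simp: primitive_base_idempotent_def)
    have ee: "e \<in> source_alg" "e \<in> target_alg" "e * e = e"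
      and cc: "c \<in> source_alg" "c \<in> target_alg" "c * c = c"
      using less.prems c by (simp_all add: base_idempotent_def)
    have ce: "c * e = c" using base_idempotent_commute(1)[OF less.prems cc(1)] c(2) by simp
    have d: "base_idempotent (e - c)"
      using ee cc subspace_diff[OF subspace_source] subspace_diff[OF subspace_target]
      by (auto simp: base_idempotent_def algebra_simps ce c(2))
    have smaller: "dim {x. b * x = x} < dim {x. e * x = x}"
      if b: "base_idempotent b" "e * b = b" "b \<noteq> e" for b
    proof (rule dim_psubset)
      have sub: "subspace {x. a * x = x}" for a
        unfolding subspace_def by (auto simp: distrib_left scale_mult_right)
      have be: "b * e = b"
        using base_idempotent_commute(1)[OF less.prems, of b] b by (simp add: base_idempotent_def)
      have "e * x = x" if "b * x = x" for x using that b(2) by (metis mult.assoc)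
      moreover have "e \<notin> {x. b * x = x}" "e \<in> {x. e * x = x}" using be b ee by auto
      ultimately show "span {x. b * x = x} \<subset> span {x. e * x = x}"
        using sub by (auto simp: span_eq_iff[THEN iffD2])
    qed
    have "e * (e - c) = e - c" "e - c \<noteq> e" using c ee by (simp_all add: right_diff_distrib)
    then have "finitely_many_classes c" "finitely_many_classes (e - c)"
      using less.hyps smaller c d by blast+
    then obtain P R where P: "finite P" "{g. grouplike g} \<subseteq> \<Union>P" "\<forall>C\<in>P. \<forall>g\<in>C. \<forall>h\<in>C. related_over c g h"
      and R: "finite R" "{g. grouplike g} \<subseteq> \<Union>R" "\<forall>C\<in>R. \<forall>g\<in>C. \<forall>h\<in>C. related_over (e - c) g h"
      unfolding finitely_many_classes_def by metis
    let ?T = "(\<lambda>(C, D). C \<inter> D) ` (P \<times> R)"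
    have "finite ?T" using P R by simp
    moreover have "{g. grouplike g} \<subseteq> \<Union>?T" using P(2) R(2) by fastforce
    moreover have "\<forall>C\<in>?T. \<forall>g\<in>C. \<forall>h\<in>C. related_over e g h"
    proof (intro ballI)
      fix K g h assume "K \<in> ?T" "g \<in> K" "h \<in> K"
      then obtain C D where "C \<in> P" "D \<in> R" "g \<in> C" "g \<in> D" "h \<in> C" "h \<in> D" by auto
      then show "related_over e g h"
        using P(3) R(3) by (intro related_over_split[OF less.prems c(1,2)]) blast+
    qed
    ultimately show ?thesis unfolding finitely_many_classes_def by blast
  qed
qed

text \<open>
  If the inverses of \<open>g\<close> and \<open>h\<close> are related over \<open>1\<close>, then \<open>h * g\<inverse>\<close> is trivial, so \<open>g\<close> and \<open>h\<close> have the same right coset.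
\<close>

lemma finite_trivial_cosets:
  "finite (carrier (group_like_group scale \<Delta> Mod trivial_group_like))"
proof -
  let ?G = "group_like_group scale \<Delta>" and ?N = trivial_group_like
  have "base_idempotent 1" by (simp add: base_idempotent_def)
  then have "finitely_many_classes 1" by (rule base_idempotent_finitely_many_classes)
  then obtain P where P: "finite P" "{g. grouplike g} \<subseteq> \<Union>P"
      "\<forall>C\<in>P. \<forall>g\<in>C. \<forall>h\<in>C. related_over 1 g h"
    unfolding finitely_many_classes_def by (elim exE conjE)
  have coset: "?N #>\<^bsub>?G\<^esub> g = (\<lambda>n. n * g) ` ?N" for g
    by (auto simp: r_coset_def group_like_group_def)
  have eq: "(\<lambda>n. n * g) ` ?N = (\<lambda>n. n * h) ` ?N"
    if g: "grouplike g" "mult_inverses g g'" and h: "grouplike h" "mult_inverses h h'"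
      and R: "related_over 1 g' h'" for g g' h h'
  proof -
    have "mult_inverses h' h" using h by (simp add: mult_inverses_def)
    then have u: "h * g' \<in> ?N"
      using related_over_one_imp_trivial[OF R group_like_inverse[OF h]] group_like_inverse[OF g] by blast
    have "mult_inverses (h * g') (g * h')"
    proof -
      have "h * g' * (g * h') = h * (g' * g) * h'" "g * h' * (h * g') = g * (h' * h) * g'"
        by (simp_all only: mult.assoc)
      then show ?thesis using g h by (simp add: mult_inverses_def)
    qed
    then have u': "g * h' \<in> ?N" by (rule trivial_group_like_inverse[OF u])
    show ?thesis
    proof (intro equalityI image_subsetI)
      fix n assume n: "n \<in> ?N"
      have "n * g = n * (g * h') * h" "n * h = n * (h * g') * g"
        using g h by (simp_all add: mult_inverses_def mult.assoc)
      then show "n * g \<in> (\<lambda>n. n * h) ` ?N" "n * h \<in> (\<lambda>n. n * g) ` ?N"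
        using trivial_group_like_mult[OF n u] trivial_group_like_mult[OF n u'] by blast+
    qed
  qed
  \<comment> \<open>A coset is indexed by a block containing the inverse of a representative, because \<open>related_over\<close> describes left cosets.\<close>
  define r where "r C = (SOME g. grouplike g \<and> (\<exists>g'\<in>C. mult_inverses g g'))" for C
  have "carrier (?G Mod ?N) \<subseteq> (\<lambda>C. ?N #>\<^bsub>?G\<^esub> r C) ` P"
  proof
    fix A assume "A \<in> carrier (?G Mod ?N)"
    then obtain g where g: "grouplike g" "A = ?N #>\<^bsub>?G\<^esub> g"
      by (auto simp: FactGroup_def RCOSETS_def group_like_group_def)
    then obtain g' where g': "mult_inverses g g'" unfolding group_like_def by blast
    then have "grouplike g'" using group_like_inverse g(1) by blast
    then obtain C where C: "C \<in> P" "g' \<in> C" using P(2) by auto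
    have "grouplike (r C) \<and> (\<exists>h'\<in>C. mult_inverses (r C) h')"
      unfolding r_def by (rule someI[of _ g]) (use g g' C in auto)
    then obtain h' where h': "grouplike (r C)" "h' \<in> C" "mult_inverses (r C) h'" by blast
    then have "A = ?N #>\<^bsub>?G\<^esub> r C"
      unfolding g(2) coset using P(3) C by (intro eq[OF g(1) g' h'(1,3)]) blast
    then show "A \<in> (\<lambda>C. ?N #>\<^bsub>?G\<^esub> r C) ` P" using C(1) by blast
  qed
  then show ?thesis using finite_imageI[OF P(1)] by (rule finite_subset)
qed

end

theorem corollary4p12:
  fixes scale :: "'k::field \<Rightarrow> 'h::{ring,monoid_mult} \<Rightarrow> 'h"
    and \<Delta> :: "'h \<Rightarrow> ('k, 'h) tensor2"
    and \<epsilon> :: "'h \<Rightarrow> 'k"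
    and S :: "'h \<Rightarrow> 'h"
  assumes "weak_hopf_algebra scale \<Delta> \<epsilon> S"
    and "\<exists>B. finite_dimensional_vector_space scale B"
  shows "finite (carrier (group_like_group scale \<Delta> Mod trivial_group_likes scale \<Delta> \<epsilon> S))"
proof -
  obtain B where "finite_dimensional_vector_space scale B" using assms(2) by blast
  then interpret finite_dimensional_weak_hopf_algebra scale \<Delta> \<epsilon> S B
    using assms(1) by (intro finite_dimensional_weak_hopf_algebra.intro)
  show ?thesis by (rule finite_trivial_cosets)
qed

end
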